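(* There is an absolute constant $C$ such that for all $t\in(1,2)$, $$p_{\rm cr}(t)<C(t-1)^{-1/2}.$$
   Context: $\mathbb T$ is the unit circle. $[w]_{A_2(\mathbb T)}:=\sup_I \langle w\rangle_I\langle w^{-1}\rangle_I$, supremum over arcs $I\subseteq\mathbb T$, $\langle g\rangle_I:=\frac1{|I|}\int_I g\,d\theta$. For a weight $w$ with $\int_{\mathbb T}\frac{w}{2\pi}d\theta=1$, $\phi_n(z,w)$ are the polynomials orthonormal with respect to $\frac{w}{2\pi}d\theta$, $\deg\phi_n=n$, with positive leading coefficient, and $L^p_w(\mathbb T)$ is $L^p$ with respect to $w\frac{d\theta}{2\pi}$. For $t\ge1$, $p_{\rm cr}(t)$ is the supremum of all $p$ such that $\sup_n\|\phi_n(\cdot,w)\|_{L^p_w(\mathbb T)}<\infty$ for every such weight $w$ with $[w]_{A_2(\mathbb T)}\le t$. *)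

theory Defs
  imports "HOL-Analysis.Analysis" "HOL-Computational_Algebra.Polynomial"
begin

text \<open>
  Functions on the unit circle are functions of a complex variable \<open>z\<close>, evaluated only at
  \<open>z = cis \<theta>\<close>.
\<close>

definition normalized_weight :: "(complex \<Rightarrow> real) \<Rightarrow> bool" where
  "normalized_weight w \<longleftrightarrow>
     (\<lambda>\<theta>. w (cis \<theta>)) \<in> borel_measurable lebesgue \<and>
     (\<forall>\<theta>. 0 \<le> w (cis \<theta>)) \<and>
     (\<integral>\<^sup>+\<theta>\<in>{0..2*pi}. ennreal (w (cis \<theta>) / (2*pi)) \<partial>lebesgue) = 1"

text \<open>
  The arcs of the circle are the sets \<open>cis ` {a..b}\<close> with \<open>a < b \<le> a + 2*pi\<close>; such an arc has
  length \<open>b - a\<close>. Averages take values in \<open>ennreal\<close> and \<open>inverse 0 = \<infinity>\<close> there, so the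
  characteristic below is infinite whenever a weight that is not almost everywhere zero
  vanishes on a set of positive measure.
\<close>

definition arc_average :: "(complex \<Rightarrow> ennreal) \<Rightarrow> real \<Rightarrow> real \<Rightarrow> ennreal" where
  "arc_average g a b = (\<integral>\<^sup>+\<theta>\<in>{a..b}. g (cis \<theta>) \<partial>lebesgue) / ennreal (b - a)"

definition A2_characteristic :: "(complex \<Rightarrow> real) \<Rightarrow> ennreal" where
  "A2_characteristic w =
     (SUP (a, b) \<in> {(a, b). a < b \<and> b \<le> a + 2*pi}.
        arc_average (\<lambda>z. ennreal (w z)) a b * arc_average (\<lambda>z. inverse (ennreal (w z))) a b)"

definition weight_measure :: "(complex \<Rightarrow> real) \<Rightarrow> real measure" where
  "weight_measure w =
     density (lebesgue_on {0..2*pi}) (\<lambda>\<theta>. ennreal (w (cis \<theta>) / (2*pi)))"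

definition weighted_inner ::
    "(complex \<Rightarrow> real) \<Rightarrow> (complex \<Rightarrow> complex) \<Rightarrow> (complex \<Rightarrow> complex) \<Rightarrow> complex" where
  "weighted_inner w f g = (LINT \<theta>|weight_measure w. f (cis \<theta>) * cnj (g (cis \<theta>)))"

definition weighted_Lp_norm :: "(complex \<Rightarrow> real) \<Rightarrow> real \<Rightarrow> (complex \<Rightarrow> complex) \<Rightarrow> real" where
  "weighted_Lp_norm w p f = (LINT \<theta>|weight_measure w. norm (f (cis \<theta>)) powr p) powr (1 / p)"

definition orthonormal_polys :: "(complex \<Rightarrow> real) \<Rightarrow> (nat \<Rightarrow> complex poly) \<Rightarrow> bool" where
  "orthonormal_polys w \<phi> \<longleftrightarrow>
     (\<forall>n. degree (\<phi> n) = n \<and> lead_coeff (\<phi> n) \<in> \<real> \<and> 0 < Re (lead_coeff (\<phi> n))) \<and>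
     (\<forall>m n. weighted_inner w (poly (\<phi> m)) (poly (\<phi> n)) = (if m = n then 1 else 0))"

definition orthonormal_poly :: "(complex \<Rightarrow> real) \<Rightarrow> nat \<Rightarrow> complex poly" where
  "orthonormal_poly w = (THE \<phi>. orthonormal_polys w \<phi>)"

text \<open>
  For a normalized weight, polynomials are bounded on the circle and hence \<open>L\<^sup>p\<close>; the Bochner
  integral in \<^const>\<open>weighted_Lp_norm\<close> is therefore the true one. The supremum is taken in
  \<open>ereal\<close> because it is infinite for \<open>t = 1\<close>.
\<close>

definition p_cr :: "real \<Rightarrow> ereal" where
  "p_cr t = Sup {ereal p | p. 1 \<le> p \<and>
     (\<forall>w. normalized_weight w \<and> A2_characteristic w \<le> ennreal t \<longrightarrow>
        bdd_above (range (\<lambda>n. weighted_Lp_norm w p (poly (orthonormal_poly w n)))))}"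


subsection \<open>Existence and uniqueness of the orthonormal polynomials\<close>

context
  fixes w :: "complex \<Rightarrow> real"
  assumes w: "normalized_weight w"
begin

lemma w_meas: "(\<lambda>\<theta>. w (cis \<theta>) / (2*pi)) \<in> borel_measurable (lebesgue_on {0..2*pi})"
proof -
  have "(\<lambda>\<theta>. w (cis \<theta>)) \<in> borel_measurable (lebesgue_on {0..2*pi})"
    using w unfolding normalized_weight_def by (intro measurable_restrict_space1) auto
  then show ?thesis by measurable
qed

lemma cont_meas:
  fixes f :: "real \<Rightarrow> complex"
  assumes "continuous_on UNIV f"
  shows "f \<in> borel_measurable (weight_measure w)"
proof -
  have "f \<in> borel_measurable lebesgue"
    using borel_measurable_continuous_onI[OF assms] by (intro measurable_completion) simp
  then have "f \<in> borel_measurable (lebesgue_on {0..2*pi})"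
    by (rule measurable_restrict_space1)
  then show ?thesis
    unfolding weight_measure_def by (simp add: measurable_def)
qed

lemma emeasure_weight_measure: "emeasure (weight_measure w) (space (weight_measure w)) = 1"
proof -
  have "emeasure (weight_measure w) (space (weight_measure w)) =
      (\<integral>\<^sup>+\<theta>. ennreal (w (cis \<theta>) / (2*pi)) \<partial>lebesgue_on {0..2*pi})"
    unfolding weight_measure_def using w_meas
    by (subst emeasure_density) (auto intro!: nn_integral_cong simp: space_restrict_space)
  also have "\<dots> = 1"
    using w unfolding normalized_weight_def by (subst nn_integral_restrict_space) auto
  finally show ?thesis .
qed

lemma finite_measure_weight: "finite_measure (weight_measure w)"
  by (rule finite_measureI) (simp add: emeasure_weight_measure)

lemma poly_cis_cont: "continuous_on A (\<lambda>\<theta>. poly p (cis \<theta>))"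
  by (intro continuous_intros)

lemma integrable_inner: "integrable (weight_measure w) (\<lambda>\<theta>. poly p (cis \<theta>) * cnj (poly q (cis \<theta>)))"
proof -
  interpret finite_measure "weight_measure w" by (rule finite_measure_weight)
  let ?f = "\<lambda>\<theta>. poly p (cis \<theta>) * cnj (poly q (cis \<theta>))"
  let ?F = "\<lambda>z. poly p z * cnj (poly q z)"
  have "compact (?F ` sphere 0 1)"
    by (intro compact_continuous_image continuous_intros) auto
  then have "bounded (?F ` sphere 0 1)" by (rule compact_imp_bounded)
  then obtain B where "\<And>z. z \<in> sphere 0 1 \<Longrightarrow> norm (?F z) \<le> B"
    unfolding bounded_iff by blast
  then have "\<And>\<theta>. norm (?f \<theta>) \<le> B" by simp
  then show ?thesis
    by (intro integrable_const_bound[of _ B] cont_meas continuous_intros) auto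
qed

abbreviation ip :: "complex poly \<Rightarrow> complex poly \<Rightarrow> complex" where
  "ip p q \<equiv> weighted_inner w (poly p) (poly q)"

lemma ip_add: "ip (p + q) r = ip p r + ip q r"
  unfolding weighted_inner_def
  by (simp add: distrib_right integrable_inner)

lemma ip_smult: "ip (smult c p) r = c * ip p r"
  unfolding weighted_inner_def by (simp add: mult.assoc)

lemma ip_diff: "ip (p - q) r = ip p r - ip q r"
  using ip_add[of p "smult (-1) q" r] ip_smult[of "-1" q r] by simp

lemma ip_cnj: "ip q p = cnj (ip p q)"
proof -
  have "ip q p = (LINT \<theta>|weight_measure w. cnj (poly p (cis \<theta>) * cnj (poly q (cis \<theta>))))"
    unfolding weighted_inner_def by (intro Bochner_Integration.integral_cong) auto
  then show ?thesis
    unfolding weighted_inner_def by (simp only: Bochner_Integration.integral_cnj)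
qed

lemma ip_0: "ip 0 q = 0"
  unfolding weighted_inner_def by simp

lemma ip_sum: "ip (\<Sum>k\<in>A. f k) r = (\<Sum>k\<in>A. ip (f k) r)"
  by (induction A rule: infinite_finite_induct)
    (simp_all only: sum.infinite sum.empty sum.insert ip_0 ip_add not_False_eq_True)

lemma ip_self: "ip p p = of_real (LINT \<theta>|weight_measure w. (norm (poly p (cis \<theta>)))\<^sup>2)"
  unfolding weighted_inner_def
  by (simp only: complex_norm_square[symmetric] of_real_power[symmetric] integral_complex_of_real)

lemma integrable_sq: "integrable (weight_measure w) (\<lambda>\<theta>. (norm (poly p (cis \<theta>)))\<^sup>2)"
  using integrable_inner[of p p]
  by (simp only: complex_norm_square[symmetric] of_real_power[symmetric]
      complex_of_real_integrable_eq)

lemma finite_zeros: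
  assumes "p \<noteq> 0"
  shows "finite {\<theta> \<in> {0..2*pi}. poly p (cis \<theta>) = 0}"
proof -
  let ?S = "{\<theta> \<in> {0..<2*pi}. poly p (cis \<theta>) = 0}"
  have "inj_on cis {0..<2*pi}"
    by (rule inj_on_inverseI[of _ Arg2pi], rule Arg2pi_unique[of 1]) (auto simp: cis_conv_exp)
  then have "inj_on cis ?S" by (rule inj_on_subset) auto
  moreover have "finite (cis ` ?S)"
    by (rule finite_subset[OF _ poly_roots_finite[OF assms]]) auto
  ultimately have "finite ?S" using finite_imageD by blast
  then show ?thesis
    by (rule finite_subset[of _ "insert (2*pi) ?S", rotated, OF finite.insertI]) auto
qed

lemma ip_self_eq_0:
  assumes "ip p p = 0"
  shows "p = 0"
proof (rule ccontr)
  assume p: "p \<noteq> 0"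
  have "(LINT \<theta>|weight_measure w. (norm (poly p (cis \<theta>)))\<^sup>2) = 0"
    using assms unfolding ip_self by simp
  then have "AE \<theta> in weight_measure w. (norm (poly p (cis \<theta>)))\<^sup>2 = 0"
    by (subst (asm) integral_nonneg_eq_0_iff_AE) (auto intro: integrable_sq)
  then have 1: "AE \<theta> in weight_measure w. poly p (cis \<theta>) = 0" by simp
  have "{\<theta> \<in> {0..2*pi}. poly p (cis \<theta>) = 0} \<in> null_sets (lebesgue_on {0..2*pi})"
    using finite_zeros[OF p]
    by (subst null_sets_restrict_space) (auto intro!: finite_imp_null_set_lborel null_sets_completionI)
  then have "AE \<theta> in lebesgue_on {0..2*pi}. \<theta> \<notin> {\<theta> \<in> {0..2*pi}. poly p (cis \<theta>) = 0}"
    by (rule AE_not_in)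
  then have "AE \<theta> in lebesgue_on {0..2*pi}. poly p (cis \<theta>) \<noteq> 0"
    by (rule AE_mp) (auto intro!: AE_I2 simp: space_restrict_space)
  then have "AE \<theta> in weight_measure w. poly p (cis \<theta>) \<noteq> 0"
    unfolding weight_measure_def using w_meas by (subst AE_density) auto
  with 1 have "AE \<theta> in weight_measure w. False" by eventually_elim auto
  then have "emeasure (weight_measure w) (space (weight_measure w)) = 0"
    by (simp add: AE_iff_measurable[OF sets.top])
  then show False using emeasure_weight_measure by simp
qed

lemma lower_degree_orthogonal:
  assumes deg: "\<And>k. degree (\<phi> k) = k" and nz: "\<And>k. \<phi> k \<noteq> 0"
    and orth: "\<And>k. k < n \<Longrightarrow> ip (\<phi> k) g = 0"
    and d: "d = 0 \<or> degree d < n"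
  shows "ip d g = 0"
  using d
proof (induction "degree d" arbitrary: d rule: less_induct)
  case less
  show ?case
  proof (cases "d = 0")
    case True
    then show ?thesis by (simp add: ip_0)
  next
    case False
    define m where "m = degree d"
    define c where "c = lead_coeff d / lead_coeff (\<phi> m)"
    define e where "e = d - smult c (\<phi> m)"
    have m: "m < n" using False less.prems by (auto simp: m_def)
    have "coeff e m = 0"
      using nz[of m] deg[of m] leading_coeff_0_iff[of "\<phi> m"] by (simp add: e_def c_def m_def)
    moreover have "degree e \<le> m"
      unfolding e_def using deg[of m] by (intro degree_diff_le) (auto simp: m_def)
    ultimately have "e = 0 \<or> degree e < m"
      by (metis le_neq_implies_less leading_coeff_0_iff)
    then have "ip e g = 0"
      using less.hyps[of e] m by (auto simp: ip_0 m_def[symmetric])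
    then show ?thesis
      using orth[OF m] unfolding e_def ip_diff ip_smult by simp
  qed
qed

lemma orthonormal_polys_unique:
  assumes "orthonormal_polys w \<phi>" "orthonormal_polys w \<psi>"
  shows "\<phi> = \<psi>"
proof
  fix n
  have deg: "\<And>k. degree (\<phi> k) = k" "\<And>k. degree (\<psi> k) = k"
    and lc: "\<And>k. lead_coeff (\<phi> k) \<in> \<real> \<and> 0 < Re (lead_coeff (\<phi> k))"
      "\<And>k. lead_coeff (\<psi> k) \<in> \<real> \<and> 0 < Re (lead_coeff (\<psi> k))"
    and ort: "\<And>m k. ip (\<phi> m) (\<phi> k) = (if m = k then 1 else 0)"
      "\<And>m k. ip (\<psi> m) (\<psi> k) = (if m = k then 1 else 0)"
    using assms unfolding orthonormal_polys_def by blast+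
  have nz: "\<phi> k \<noteq> 0" "\<psi> k \<noteq> 0" for k using lc(1)[of k] lc(2)[of k] by auto
  obtain a b where ab: "lead_coeff (\<phi> n) = of_real a" "lead_coeff (\<psi> n) = of_real b" "a > 0" "b > 0"
    using lc(1)[of n] lc(2)[of n] by (metis Reals_cases Re_complex_of_real)
  define c :: real where "c = a / b"
  have c: "c > 0" using ab by (simp add: c_def)
  define d where "d = \<phi> n - smult (of_real c) (\<psi> n)"
  have "coeff d n = 0" using ab deg by (simp add: d_def c_def)
  moreover have "degree d \<le> n" unfolding d_def using deg by (intro degree_diff_le) auto
  ultimately have dd: "d = 0 \<or> degree d < n" by (metis le_neq_implies_less leading_coeff_0_iff)
  have "ip d (\<phi> n) = 0" "ip d (\<psi> n) = 0"
    using lower_degree_orthogonal[of \<phi> n, OF deg(1) nz(1) _ dd]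
      lower_degree_orthogonal[of \<psi> n, OF deg(2) nz(2) _ dd] ort by simp_all
  then have "ip (\<phi> n) d = 0" "ip (\<psi> n) d = 0"
    using ip_cnj[of "\<phi> n" d] ip_cnj[of "\<psi> n" d] by simp_all
  then have "ip d d = 0"
    by (subst (1) d_def) (simp only: ip_diff ip_smult, simp)
  then have "d = 0" by (rule ip_self_eq_0)
  then have eq: "\<phi> n = smult (of_real c) (\<psi> n)" by (simp add: d_def)
  have "1 = ip (\<phi> n) (\<phi> n)" using ort by simp
  also have "\<dots> = of_real c * cnj (ip (smult (of_real c) (\<psi> n)) (\<psi> n))"
    unfolding eq ip_smult[of _ _ "smult (of_real c) (\<psi> n)"] ip_cnj[of "\<psi> n"] by simp
  also have "\<dots> = of_real (c\<^sup>2)"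
    using ort(2)[of n n] by (simp add: ip_smult power2_eq_square)
  finally have "c\<^sup>2 = 1" by (metis of_real_eq_1_iff)
  then have "c = 1" using c by (simp add: power2_eq_1_iff)
  then show "\<phi> n = \<psi> n" using eq by simp
qed

lemma orthonormal_polys_exist: "\<exists>\<phi>. orthonormal_polys w \<phi>"
proof -
  define P where "P = (\<lambda>\<phi> n r. degree r = n \<and> lead_coeff r \<in> \<real> \<and> 0 < Re (lead_coeff r) \<and>
     ip r r = 1 \<and> (\<forall>k<n. ip r (\<phi> k) = 0))"
  have "\<exists>\<phi>. \<forall>n. P \<phi> n (\<phi> n)"
  proof (rule dependent_wf_choice[OF wf_less_than])
    fix f g :: "nat \<Rightarrow> complex poly" and n r
    assume "\<And>z. (z, n) \<in> less_than \<Longrightarrow> f z = g z"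
    then show "P f n r = P g n r" unfolding P_def by auto
  next
    fix n and \<phi> :: "nat \<Rightarrow> complex poly"
    assume "\<And>k. (k, n) \<in> less_than \<Longrightarrow> P \<phi> k (\<phi> k)"
    then have IH: "P \<phi> k (\<phi> k)" if "k < n" for k using that by simp
    have ort: "ip (\<phi> k) (\<phi> l) = (if k = l then 1 else 0)" if "k < n" "l < n" for k l
      using IH[OF that(1)] IH[OF that(2)] ip_cnj[of "\<phi> k" "\<phi> l"] unfolding P_def
      by (cases k l rule: linorder_cases) auto
    define X :: "complex poly" where "X = monom 1 n"
    define s where "s = (\<Sum>k<n. smult (ip X (\<phi> k)) (\<phi> k))"
    define q where "q = X - s"
    have sc: "coeff s j = 0" if "j \<ge> n" for j
      unfolding s_def coeff_sum
    proof (rule sum.neutral, rule ballI)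
      fix k assume "k \<in> {..<n}"
      then have "degree (\<phi> k) < j" using IH[of k] that unfolding P_def by auto
      then show "coeff (smult (ip X (\<phi> k)) (\<phi> k)) j = 0" by (simp add: coeff_eq_0)
    qed
    have q1: "coeff q n = 1" using sc[of n] by (simp add: q_def X_def)
    have "degree q \<le> n"
      by (rule degree_le) (use sc in \<open>auto simp: q_def X_def\<close>)
    then have qd: "degree q = n" using q1 le_degree[of q n] by simp
    have qo: "ip q (\<phi> l) = 0" if "l < n" for l
    proof -
      have "ip s (\<phi> l) = (\<Sum>k<n. ip X (\<phi> k) * (if k = l then 1 else 0))"
        unfolding s_def ip_sum ip_smult by (rule sum.cong) (auto simp: ort that)
      also have "\<dots> = ip X (\<phi> l)"
        using that by (simp add: if_distrib[of "(*) _"] sum.delta cong: if_cong)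
      finally show ?thesis unfolding q_def ip_diff by simp
    qed
    define N where "N = (LINT \<theta>|weight_measure w. (norm (poly q (cis \<theta>)))\<^sup>2)"
    have N: "ip q q = of_real N" unfolding N_def by (rule ip_self)
    have "N \<ge> 0" unfolding N_def by simp
    moreover have "N \<noteq> 0" using ip_self_eq_0[of q] q1 N by auto
    ultimately have N0: "N > 0" by simp
    define c where "c = 1 / sqrt N"
    have c0: "c > 0" and cN: "c * c * N = 1"
      using N0 by (simp_all add: c_def)
    define r where "r = smult (of_real c) q"
    have "ip r r = of_real c * cnj (ip r q)"
      unfolding r_def ip_smult[of _ _ "smult (of_real c) q"] ip_cnj[of q "smult (of_real c) q"] by simp
    also have "\<dots> = of_real (c * c * N)" by (simp add: r_def ip_smult N)
    finally have "ip r r = 1" using cN by simp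
    moreover have "degree r = n" "lead_coeff r = of_real c"
      using c0 qd q1 by (simp_all add: r_def)
    ultimately have "P \<phi> n r"
      using c0 qo unfolding P_def by (simp add: r_def ip_smult)
    then show "\<exists>r. P \<phi> n r" by blast
  qed
  then obtain \<phi> where \<phi>: "\<And>n. P \<phi> n (\<phi> n)" by blast
  have "ip (\<phi> m) (\<phi> n) = (if m = n then 1 else 0)" for m n
    using \<phi>[of m] \<phi>[of n] ip_cnj[of "\<phi> m" "\<phi> n"] unfolding P_def
    by (cases m n rule: linorder_cases) auto
  then show ?thesis using \<phi> unfolding P_def orthonormal_polys_def by blast
qed

lemma orthonormal_polys_orthonormal_poly: "orthonormal_polys w (orthonormal_poly w)"
  unfolding orthonormal_poly_def
  using orthonormal_polys_exist orthonormal_polys_unique by (metis (no_types, lifting) the_equality)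

end

end

theory Submission
  imports Defs
begin

text \<open>
  The weight is \<open>w = c |z - 1| powr \<alpha>\<close> with \<open>\<alpha>\<close> a small multiple of \<open>sqrt (t - 1)\<close>.

  For a weight \<open>v\<close> and \<open>0 \<le> s \<le> 1\<close>, averaging the pointwise inequality
  \<open>cosh (s x) \<le> 1 - s\<^sup>2 + s\<^sup>2 cosh x\<close> with \<open>x = ln (v \<xi> / v \<eta>)\<close> over \<open>\<xi>, \<eta>\<close> in an arc gives
  \<open>[v powr s] \<le> 1 - s\<^sup>2 + s\<^sup>2 [v]\<close> for the \<open>A\<^sub>2\<close> characteristics. As \<open>v = |z - 1| powr (1/2)\<close> has
  \<open>[v] \<le> 17\<close>, the weight \<open>v powr s\<close> has characteristic at most \<open>1 + 16 s\<^sup>2\<close>.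

  Let \<open>D\<close> be the Dirichlet polynomial \<open>\<Sum>i<N. z ^ i\<close>. Since \<open>|D| |z - 1| \<le> 2\<close>, its squared norm in
  \<open>L\<^sup>2\<^sub>w\<close> is \<open>O (N powr (1 - \<alpha>/2))\<close>, while \<open>D 1 = N\<close>. By the extremal property of the reproducing kernel,
  \<open>\<Sum>k<N. |\<phi>\<^sub>k 1|\<^sup>2\<close> is at least of order \<open>N powr (1 + \<alpha>/2)\<close>. On the other hand, bounding the
  polynomial \<open>\<phi>\<^sub>k ^ m\<close> at \<open>1\<close> by its degree times its \<open>L\<^sup>1\<close> norm shows that \<open>|\<phi>\<^sub>k 1| ^ m = O (k)\<close> if
  the norms of \<open>\<phi>\<^sub>k\<close> in \<open>L\<^sup>p\<^sub>w\<close> are bounded for some \<open>p \<ge> 2 m\<close>. This is a contradiction for \<open>m > 4 / \<alpha>\<close>.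
\<close>

section \<open>A convexity-type inequality for powers of a ratio\<close>

text \<open>Termwise comparison of the power series: the terms at \<open>n = 0\<close> are both 1,
  odd terms vanish, and \<open>s ^ n \<le> s\<^sup>2\<close> for even
  \<open>n \<ge> 2\<close>.\<close>

lemma cosh_scale_le:
  fixes x s :: real
  assumes "0 \<le> s" "s \<le> 1"
  shows "cosh (s*x) \<le> 1 - s\<^sup>2 + s\<^sup>2 * cosh x"
proof (rule sums_le)
  let ?c = "\<lambda>y n. if even n then y ^ n /\<^sub>R fact n else (0::real)"
  show "?c (s*x) sums cosh (s*x)" by (rule cosh_converges)
  show "(\<lambda>n. (if n = 0 then 1 - s\<^sup>2 else 0) + s\<^sup>2 * ?c x n) sums (1 - s\<^sup>2 + s\<^sup>2 * cosh x)"
    by (intro sums_add sums_mult cosh_converges sums_single)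
  fix n
  show "?c (s*x) n \<le> (if n = 0 then 1 - s\<^sup>2 else 0) + s\<^sup>2 * ?c x n"
  proof (cases "even n \<and> n \<noteq> 0")
    case True
    then have "2 \<le> n" by (auto elim: evenE)
    then have "s ^ n \<le> s\<^sup>2" using assms by (intro power_decreasing) auto
    moreover have "0 \<le> x ^ n" using True by (simp add: zero_le_even_power)
    ultimately have "s ^ n * x ^ n / fact n \<le> s\<^sup>2 * x ^ n / fact n"
      by (intro divide_right_mono mult_right_mono) auto
    then show ?thesis using True
      by (simp add: power_mult_distrib divide_inverse mult_ac)
  qed auto
qed

text \<open>This is \<open>cosh_scale_le\<close> at \<open>x = ln r\<close>, doubled. In the
  application \<open>r\<close> is the ratio of two values of a weight.\<close>

lemma powr_plus_inverse_le:
  fixes r s :: real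
  assumes "0 < r" "0 \<le> s" "s \<le> 1"
  shows "r powr s + inverse (r powr s) \<le> 2 * (1 - s\<^sup>2) + s\<^sup>2 * (r + inverse r)"
proof -
  have "2 * cosh (s * ln r) = r powr s + inverse (r powr s)" "2 * cosh (ln r) = r + inverse r"
    using assms(1) by (simp_all add: cosh_field_def powr_def exp_minus)
  moreover have "2 * cosh (s * ln r) \<le> 2 * (1 - s\<^sup>2) + s\<^sup>2 * (2 * cosh (ln r))"
    using cosh_scale_le[OF assms(2,3), of "ln r"] by simp
  ultimately show ?thesis by simp
qed

section \<open>Integrals of the inverse square root of the chord\<close>

text \<open>By concavity, the graph of sine lies above its chord between 0 and
  \<open>pi/2\<close>.\<close>

lemma Jordan_sin_ge:
  fixes x :: real
  assumes "0 \<le> x" "x \<le> pi/2"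
  shows "2 * x / pi \<le> sin x"
proof -
  have "concave_on {0..pi} (sin :: real \<Rightarrow> real)"
    by (rule f''_le0_imp_concave[where f' = cos and f'' = "\<lambda>x. - sin x"])
      (auto intro!: derivative_eq_intros sin_ge_zero)
  from concave_onD[OF this, of "2*x/pi" 0 "pi/2"] assms
  show ?thesis by (simp add: field_simps)
qed

lemma has_integral_inverse_sqrt_abs:
  fixes a b c :: real
  assumes "a \<le> b"
  shows "((\<lambda>x. inverse (sqrt \<bar>x - c\<bar>)) has_integral (2 * sqrt (b - c) - 2 * sqrt (a - c))) {a..b}"
  \<comment> \<open>\<^const>\<open>sqrt\<close> is odd on the reals, so the same antiderivative works on both sides of \<open>c\<close>.\<close>
proof (rule fundamental_theorem_of_calculus_interior_strong[of "{c}"])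
  show "((\<lambda>x. 2 * sqrt (x - c)) has_vector_derivative inverse (sqrt \<bar>x - c\<bar>)) (at x)"
    if "x \<in> {a<..<b} - {c}" for x
  proof -
    have "DERIV sqrt (x - c) :> inverse (sqrt \<bar>x - c\<bar>) / 2"
      using that by (intro DERIV_real_sqrt_generic) (auto simp: real_sqrt_minus[of "c - x", simplified])
    then have "((\<lambda>x. 2 * sqrt (x - c)) has_real_derivative 2 * (inverse (sqrt \<bar>x - c\<bar>) / 2 * 1)) (at x)"
      by (intro DERIV_cmult DERIV_chain2) (auto intro!: derivative_eq_intros)
    then show ?thesis by (simp add: has_real_derivative_iff_has_vector_derivative)
  qed
qed (use assms in \<open>auto intro!: continuous_intros\<close>)

text \<open>Since \<open>sqrt\<close> is odd, the arguments may have either sign. The factor 2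
  serves the case \<open>x < 0 \<le> y\<close>, where \<open>sqrt y\<close> and
  \<open>sqrt (- x)\<close> are each at most \<open>sqrt (y - x)\<close>.\<close>

lemma sqrt_diff_le:
  fixes x y :: real
  assumes "x \<le> y"
  shows "sqrt y - sqrt x \<le> 2 * sqrt (y - x)"
proof -
  consider "0 \<le> x" | "x < 0" "0 \<le> y" | "y < 0" by linarith
  then show ?thesis
  proof cases
    case 1
    then show ?thesis using sqrt_add_le_add_sqrt[of x "y - x"] assms
      real_sqrt_ge_zero[of "y - x"] by (simp del: real_sqrt_ge_0_iff)
  next
    case 2
    then have "sqrt y \<le> sqrt (y - x)" "sqrt (- x) \<le> sqrt (y - x)"
      by (intro real_sqrt_le_mono; simp)+
    then show ?thesis by (simp only: real_sqrt_minus)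
  next
    case 3
    then show ?thesis using sqrt_add_le_add_sqrt[of "-y" "y - x"] assms
      real_sqrt_ge_zero[of "y - x"] by (simp add: real_sqrt_minus del: real_sqrt_ge_0_iff)
  qed
qed

text \<open>The bound is uniform in the position \<open>c\<close> of the singularity, so that it
  later applies to any multiple of \<open>2 * pi\<close>.\<close>

lemma nn_integral_inverse_sqrt_abs:
  fixes a b c :: real
  assumes "a \<le> b"
  shows "(\<integral>\<^sup>+x\<in>{a..b}. inverse (ennreal (sqrt \<bar>x - c\<bar>)) \<partial>lebesgue) \<le> ennreal (4 * sqrt (b - a))"
proof -
  have "(\<integral>\<^sup>+x\<in>{a..b}. inverse (ennreal (sqrt \<bar>x - c\<bar>)) \<partial>lebesgue) =
      (\<integral>\<^sup>+x\<in>{a..b}. inverse (ennreal (sqrt \<bar>x - c\<bar>)) \<partial>lborel)"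
    by (rule nn_integral_completion) measurable
  also have "\<dots> = (\<integral>\<^sup>+x. ennreal (indicator {a..b} x * inverse (sqrt \<bar>x - c\<bar>)) \<partial>lborel)"
  proof (rule nn_integral_cong_AE)
    \<comment> \<open>At \<open>x = c\<close> the \<open>ennreal\<close> inverse is infinite but the
      real inverse is 0, so the integrands can differ at this one point.\<close>
    show "AE x in lborel. inverse (ennreal (sqrt \<bar>x - c\<bar>)) * indicator {a..b} x =
        ennreal (indicator {a..b} x * inverse (sqrt \<bar>x - c\<bar>))"
      using AE_lborel_singleton[of c]
      by eventually_elim (auto simp: inverse_ennreal split: split_indicator)
  qed
  also have "\<dots> = ennreal (2 * sqrt (b - c) - 2 * sqrt (a - c))"
    by (rule nn_integral_has_integral_lebesgue[OF _ has_integral_inverse_sqrt_abs[OF assms]]) auto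
  also have "\<dots> \<le> ennreal (4 * sqrt (b - a))"
    using sqrt_diff_le[of "a - c" "b - c"] assms by (intro ennreal_leI) simp
  finally show ?thesis .
qed

lemma cis_2pi_periodic: "cis (\<theta> - 2 * pi * of_int m) = cis \<theta>"
proof -
  have "cis (2 * pi * of_int m) = 1" by (rule cis_multiple_2pi) auto
  then show ?thesis by (simp add: cis_divide[symmetric])
qed

text \<open>The chord equals \<open>2 * \<bar>sin (\<theta> / 2)\<bar>\<close>, to which Jordan's
  inequality applies.\<close>

lemma chord_ge:
  assumes "\<bar>\<theta>\<bar> \<le> pi"
  shows "2 * \<bar>\<theta>\<bar> / pi \<le> cmod (cis \<theta> - 1)"
proof -
  have "2 * (\<bar>\<theta>\<bar> / 2) / pi \<le> sin (\<bar>\<theta>\<bar> / 2)"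
    using assms by (intro Jordan_sin_ge) auto
  also have "sin (\<bar>\<theta>\<bar> / 2) \<le> \<bar>sin (\<theta> / 2)\<bar>"
    by (cases "\<theta> \<ge> 0") auto
  finally show ?thesis using dist_exp_i_1[of \<theta>] by (simp add: cis_conv_exp)
qed

lemma chord_lipschitz: "cmod (cis x - 1) \<le> cmod (cis y - 1) + \<bar>x - y\<bar>"
proof -
  have "cmod (cis x - cis y) = cmod (cis y * (cis (x - y) - 1))"
    by (simp add: algebra_simps cis_mult)
  also have "\<dots> = 2 * \<bar>sin ((x - y) / 2)\<bar>"
    using dist_exp_i_1[of "x - y"] by (simp add: norm_mult cis_conv_exp)
  also have "\<dots> \<le> \<bar>x - y\<bar>"
    using abs_sin_x_le_abs_x[of "(x - y) / 2"] by simp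
  finally show ?thesis using norm_triangle_ineq[of "cis x - cis y" "cis y - 1"] by simp
qed

lemma inverse_ennreal_antimono:
  fixes x y :: ennreal
  shows "x \<le> y \<Longrightarrow> inverse y \<le> inverse x"
  by (simp add: less_eq_ennreal.rep_eq inverse_ennreal.rep_eq ereal_inverse_antimono)

text \<open>The chord is comparable to the distance from \<open>\<theta>\<close> to the nearest
  multiple of \<open>2 * pi\<close>. On an interval of length at most \<open>2 * pi\<close> starting
  at \<open>a\<close>, only the multiples with index \<open>k\<close> and \<open>k + 1\<close> can
  be nearest; adding both terms gives one bound for the whole interval.\<close>

lemma inverse_sqrt_chord_le:
  assumes "a \<le> \<theta>" "\<theta> \<le> a + 2 * pi"
  defines "k \<equiv> round (a / (2 * pi))"
  shows "inverse (ennreal (sqrt (cmod (cis \<theta> - 1)))) \<le>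
     2 * (inverse (ennreal (sqrt \<bar>\<theta> - 2 * pi * of_int k\<bar>)) +
          inverse (ennreal (sqrt \<bar>\<theta> - 2 * pi * of_int (k + 1)\<bar>)))"
proof -
  define m where "m = round (\<theta> / (2 * pi))"
  have "k \<le> m" unfolding k_def m_def using assms by (intro round_mono divide_right_mono) auto
  moreover have "m \<le> round (a / (2 * pi) + 1)"
    unfolding m_def using assms by (intro round_mono) (simp add: field_simps)
  moreover have "round (a / (2 * pi) + 1) = k + 1"
    unfolding k_def round_def by linarith
  ultimately have m: "m = k \<or> m = k + 1" by linarith
  let ?d = "\<bar>\<theta> - 2 * pi * of_int m\<bar>"
  have "\<bar>of_int m - \<theta> / (2 * pi)\<bar> \<le> 1/2" unfolding m_def by (rule of_int_round_abs_le)
  then have "?d \<le> pi" by (simp add: abs_le_iff field_simps)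
  from chord_ge[OF this] have "2 * ?d / pi \<le> cmod (cis \<theta> - 1)" by (simp only: cis_2pi_periodic)
  \<comment> \<open>The coarser constant 1/4 has a rational square root, which yields the factor 2
    of the statement.\<close>
  moreover have "?d / 4 \<le> 2 * ?d / pi" using pi_less_4 by (simp add: field_simps mult_right_mono)
  ultimately have "sqrt (?d / 4) \<le> sqrt (cmod (cis \<theta> - 1))" by (intro real_sqrt_le_mono) simp
  then have "sqrt ?d / 2 \<le> sqrt (cmod (cis \<theta> - 1))" by (simp add: real_sqrt_divide)
  then have "inverse (ennreal (sqrt (cmod (cis \<theta> - 1)))) \<le> inverse (ennreal (sqrt ?d / 2))"
    by (intro inverse_ennreal_antimono ennreal_leI)
  also have "\<dots> \<le> 2 * inverse (ennreal (sqrt ?d))"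
  proof (cases "?d = 0")
    case False
    then have "0 < sqrt ?d" by simp
    then have "inverse (ennreal (sqrt ?d / 2)) = ennreal 2 * inverse (ennreal (sqrt ?d))"
      by (simp add: inverse_ennreal ennreal_mult[symmetric] field_simps del: ennreal_numeral real_sqrt_gt_0_iff)
    then show ?thesis by simp
  qed simp
  also have "\<dots> \<le> 2 * (inverse (ennreal (sqrt \<bar>\<theta> - 2 * pi * of_int k\<bar>)) +
          inverse (ennreal (sqrt \<bar>\<theta> - 2 * pi * of_int (k + 1)\<bar>)))"
    using m by (intro mult_left_mono) auto
  finally show ?thesis .
qed

lemma nn_integral_inverse_sqrt_chord:
  assumes "a \<le> b" "b \<le> a + 2 * pi"
  shows "(\<integral>\<^sup>+\<theta>. inverse (ennreal (sqrt (cmod (cis \<theta> - 1)))) \<partial>lebesgue_on {a..b}) \<le> ennreal (16 * sqrt (b - a))"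
proof -
  define k where "k = round (a / (2 * pi))"
  let ?f = "\<lambda>j \<theta>. inverse (ennreal (sqrt \<bar>\<theta> - 2 * pi * of_int j\<bar>))"
  have [measurable]: "?f j \<in> borel_measurable (lebesgue_on {a..b})" for j
    by (intro measurable_restrict_space1 measurable_completion) simp
  have f: "(\<integral>\<^sup>+\<theta>. ?f j \<theta> \<partial>lebesgue_on {a..b}) \<le> ennreal (4 * sqrt (b - a))" for j
    using nn_integral_inverse_sqrt_abs[OF assms(1), of "2 * pi * of_int j"]
    by (simp add: nn_integral_restrict_space)
  have "(\<integral>\<^sup>+\<theta>. inverse (ennreal (sqrt (cmod (cis \<theta> - 1)))) \<partial>lebesgue_on {a..b}) \<le>
     (\<integral>\<^sup>+\<theta>. 2 * (?f k \<theta> + ?f (k + 1) \<theta>) \<partial>lebesgue_on {a..b})"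
    unfolding k_def using assms
    by (intro nn_integral_mono inverse_sqrt_chord_le) (auto simp: space_restrict_space)
  also have "\<dots> = 2 * ((\<integral>\<^sup>+\<theta>. ?f k \<theta> \<partial>lebesgue_on {a..b}) + (\<integral>\<^sup>+\<theta>. ?f (k + 1) \<theta> \<partial>lebesgue_on {a..b}))"
    by (simp add: nn_integral_cmult nn_integral_add del: of_int_add)
  also have "\<dots> \<le> 2 * (ennreal (4 * sqrt (b - a)) + ennreal (4 * sqrt (b - a)))"
    by (intro mult_left_mono add_mono f) simp
  also have "\<dots> = ennreal 2 * ennreal (8 * sqrt (b - a))"
    using assms by (simp add: ennreal_plus[symmetric] del: ennreal_plus)
  also have "\<dots> = ennreal (16 * sqrt (b - a))"
    using assms by (simp add: ennreal_mult[symmetric] del: ennreal_numeral)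
  finally show ?thesis .
qed

section \<open>The \<open>A\<^sub>2\<close> characteristic of power weights with small
  exponent\<close>

text \<open>The pointwise inequality is integrated in both variables. Each product then factors, and
  the two symmetric terms account for the factors 2.\<close>

lemma nn_integral_product_le:
  fixes u u' v v' :: "'a \<Rightarrow> ennreal"
  assumes [measurable]: "u \<in> borel_measurable M" "u' \<in> borel_measurable M"
      "v \<in> borel_measurable M" "v' \<in> borel_measurable M"
    and le: "\<And>x y. u x * u' y + u y * u' x \<le> A + B * (v x * v' y + v y * v' x)"
  shows "2 * (integral\<^sup>N M u * integral\<^sup>N M u') \<le>
     A * emeasure M (space M) * emeasure M (space M) + B * (2 * (integral\<^sup>N M v * integral\<^sup>N M v'))"
proof -
  have "(\<integral>\<^sup>+y. \<integral>\<^sup>+x. u x * u' y + u y * u' x \<partial>M \<partial>M) \<le>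
     (\<integral>\<^sup>+y. \<integral>\<^sup>+x. A + B * (v x * v' y + v y * v' x) \<partial>M \<partial>M)"
    by (intro nn_integral_mono le)
  also have "(\<integral>\<^sup>+y. \<integral>\<^sup>+x. u x * u' y + u y * u' x \<partial>M \<partial>M) =
      2 * (integral\<^sup>N M u * integral\<^sup>N M u')"
    by (simp add: nn_integral_add nn_integral_cmult nn_integral_multc mult_2)
  also have "(\<integral>\<^sup>+y. \<integral>\<^sup>+x. A + B * (v x * v' y + v y * v' x) \<partial>M \<partial>M) =
     A * emeasure M (space M) * emeasure M (space M) + B * (2 * (integral\<^sup>N M v * integral\<^sup>N M v'))"
    by (simp add: nn_integral_add nn_integral_cmult nn_integral_multc mult_2)
  finally show ?thesis .
qed

lemma chord_borel_measurable [measurable]: "(\<lambda>\<theta>. cmod (cis \<theta> - 1)) \<in> borel_measurable borel"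
  by (intro borel_measurable_continuous_onI continuous_intros)

lemma borel_imp_lebesgue_on:
  fixes f :: "real \<Rightarrow> 'b::topological_space"
  shows "f \<in> borel_measurable borel \<Longrightarrow> f \<in> borel_measurable (lebesgue_on A)"
  by (intro measurable_restrict_space1 measurable_completion) simp

lemma emeasure_lebesgue_on_interval:
  fixes a b :: real
  shows "a \<le> b \<Longrightarrow> emeasure (lebesgue_on {a..b}) (space (lebesgue_on {a..b})) = ennreal (b - a)"
  by (simp add: emeasure_restrict_space space_restrict_space)

text \<open>On an interval of length \<open>L = b - a\<close> the function \<open>v\<close>
  satisfies \<open>v x \<le> v y + sqrt L\<close>. Dividing by \<open>v y\<close> and integrating in
  both variables gives at most \<open>L\<^sup>2 + sqrt L * (16 * sqrt L) * L\<close>, hence the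
  constant 17.\<close>

lemma sqrt_chord_A2_bound:
  assumes "a \<le> b" "b \<le> a + 2 * pi"
  shows "(\<integral>\<^sup>+\<theta>. ennreal (sqrt (cmod (cis \<theta> - 1))) \<partial>lebesgue_on {a..b}) *
     (\<integral>\<^sup>+\<theta>. inverse (ennreal (sqrt (cmod (cis \<theta> - 1)))) \<partial>lebesgue_on {a..b}) \<le> ennreal (17 * (b - a)\<^sup>2)"
proof -
  let ?M = "lebesgue_on {a..b}" and ?L = "ennreal (b - a)"
  define v where "v = (\<lambda>\<theta>. ennreal (sqrt (cmod (cis \<theta> - 1))))"
  have [measurable]: "v \<in> borel_measurable ?M" unfolding v_def by (intro borel_imp_lebesgue_on) measurable
  define R where "R = ennreal (sqrt (b - a))"
  have R: "R * R = ?L" using assms(1) by (simp add: R_def ennreal_mult[symmetric])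
  have V': "(\<integral>\<^sup>+\<theta>. inverse (v \<theta>) \<partial>?M) \<le> 16 * R"
    using nn_integral_inverse_sqrt_chord[OF assms] assms(1) unfolding v_def R_def
    by (simp add: ennreal_mult)
  have le: "v x * inverse (v y) \<le> 1 + R * inverse (v y)" if "x \<in> {a..b}" "y \<in> {a..b}" for x y
  proof -
    have "sqrt (cmod (cis x - 1)) \<le> sqrt (cmod (cis y - 1) + \<bar>x - y\<bar>)"
      by (intro real_sqrt_le_mono chord_lipschitz)
    also have "\<dots> \<le> sqrt (cmod (cis y - 1)) + sqrt \<bar>x - y\<bar>"
      by (intro sqrt_add_le_add_sqrt) auto
    also have "sqrt \<bar>x - y\<bar> \<le> sqrt (b - a)"
      using that by (intro real_sqrt_le_mono) auto
    finally have "v x \<le> v y + R" unfolding v_def R_def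
      using assms(1) by (simp add: ennreal_plus[symmetric] del: ennreal_plus)
    then have "v x * inverse (v y) \<le> (v y + R) * inverse (v y)" by (intro mult_right_mono) auto
    also have "\<dots> = v y * inverse (v y) + R * inverse (v y)" by (simp add: distrib_right)
    \<comment> \<open>Where \<open>v y = 0\<close> the product is \<open>0 * top = 0\<close> in
      \<open>ennreal\<close>.\<close>
    also have "v y * inverse (v y) \<le> 1"
      by (cases "v y = 0") (auto simp: v_def divide_ennreal_def[symmetric] ennreal_divide_self)
    finally show ?thesis by simp
  qed
  have "(\<integral>\<^sup>+\<theta>. v \<theta> \<partial>?M) * (\<integral>\<^sup>+\<theta>. inverse (v \<theta>) \<partial>?M) = (\<integral>\<^sup>+y. \<integral>\<^sup>+x. v x * inverse (v y) \<partial>?M \<partial>?M)"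
    by (simp add: nn_integral_cmult nn_integral_multc)
  also have "\<dots> \<le> (\<integral>\<^sup>+y. \<integral>\<^sup>+x. 1 + R * inverse (v y) \<partial>?M \<partial>?M)"
    by (intro nn_integral_mono le) (auto simp: space_restrict_space)
  also have "\<dots> = ?L * ?L + R * (\<integral>\<^sup>+\<theta>. inverse (v \<theta>) \<partial>?M) * ?L"
    using emeasure_lebesgue_on_interval[OF assms(1)]
    by (simp add: nn_integral_cmult nn_integral_multc nn_integral_add distrib_right)
  also have "\<dots> \<le> ?L * ?L + R * (16 * R) * ?L"
    by (intro add_mono mult_right_mono mult_left_mono V') auto
  also have "\<dots> = 17 * (?L * ?L)"
  proof -
    have "R * (16 * R) = 16 * ?L" by (simp add: R[symmetric] mult_ac)
    moreover have "1 * (?L * ?L) + 16 * (?L * ?L) = 17 * (?L * ?L)"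
      by (simp only: distrib_right[symmetric]) simp
    ultimately show ?thesis by (simp add: mult_ac)
  qed
  also have "\<dots> = ennreal (17 * (b - a)\<^sup>2)"
    using assms(1) by (simp add: ennreal_mult power2_eq_square)
  finally show ?thesis unfolding v_def .
qed

definition power_weight :: "real \<Rightarrow> real \<Rightarrow> complex \<Rightarrow> real" where
  "power_weight c \<alpha> z = c * cmod (z - 1) powr \<alpha>"

text \<open>The constant \<open>c\<close> cancels in the quotients, and the chord to the power
  \<open>s / 2\<close> is the \<open>s\<close>-th power of its square root, so
  \<open>powr_plus_inverse_le\<close> applies to the ratio of the square roots.\<close>

lemma power_weight_ratio:
  fixes x y :: complex
  assumes c: "0 < c" and s: "0 < s" "s \<le> 1"
  defines "u \<equiv> \<lambda>z. ennreal (power_weight c (s / 2) z)"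
    and "v \<equiv> \<lambda>z. ennreal (sqrt (cmod (z - 1)))"
  shows "u x * inverse (u y) + u y * inverse (u x) \<le>
     ennreal (2 * (1 - s\<^sup>2)) + ennreal (s\<^sup>2) * (v x * inverse (v y) + v y * inverse (v x))"
proof (cases "x = 1 \<or> y = 1")
  case True
  have [simp]: "v z = 0 \<longleftrightarrow> z = 1" for z unfolding v_def by simp
  have [simp]: "u 1 = 0" unfolding u_def power_weight_def by simp
  \<comment> \<open>If exactly one point is the zero of the weight, the right-hand side is infinite.
    If both are, the left-hand side is 0 because \<open>0 * top = 0\<close>.\<close>
  have "x = 1 \<and> y = 1 \<or> v x * inverse (v y) + v y * inverse (v x) = top"
    using True by (auto simp: ennreal_mult_eq_top_iff)
  then show ?thesis
  proof
    assume "v x * inverse (v y) + v y * inverse (v x) = top"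
    then have "ennreal (s\<^sup>2) * (v x * inverse (v y) + v y * inverse (v x)) = top"
      using s by (simp only: ennreal_mult_eq_top_iff) simp
    then show ?thesis by simp
  qed auto
next
  case False
  define r where "r = sqrt (cmod (x - 1)) / sqrt (cmod (y - 1))"
  have r: "0 < r" using False by (simp add: r_def)
  have p: "cmod (z - 1) powr (s / 2) = sqrt (cmod (z - 1)) powr s" for z
    by (simp add: powr_half_sqrt[symmetric] powr_powr)
  have pos: "0 < sqrt (cmod (x - 1))" "0 < sqrt (cmod (y - 1))" using False by auto
  have 1: "u x * inverse (u y) = ennreal (r powr s)" "u y * inverse (u x) = ennreal (inverse (r powr s))"
    unfolding u_def power_weight_def p r_def using pos c
    by (simp_all add: inverse_ennreal ennreal_mult[symmetric] powr_divide field_simps)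
  have 2: "v x * inverse (v y) = ennreal r" "v y * inverse (v x) = ennreal (inverse r)"
    unfolding v_def r_def using pos
    by (simp_all add: inverse_ennreal ennreal_mult[symmetric] field_simps)
  have "s\<^sup>2 \<le> 1" using s by (simp add: power_le_one)
  then have "ennreal (2 * (1 - s\<^sup>2)) + ennreal (s\<^sup>2) * (ennreal r + ennreal (inverse r)) =
      ennreal (2 * (1 - s\<^sup>2) + s\<^sup>2 * (r + inverse r))"
    using r by (simp add: ennreal_mult[symmetric] ennreal_plus[symmetric] del: ennreal_plus)
  moreover have "ennreal (r powr s) + ennreal (inverse (r powr s)) = ennreal (r powr s + inverse (r powr s))"
    by (simp add: ennreal_plus[symmetric] del: ennreal_plus)
  ultimately show ?thesis unfolding 1 2
    using powr_plus_inverse_le[OF r, of s] s by (simp add: ennreal_leI del: ennreal_plus)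
qed

text \<open>Integrating \<open>power_weight_ratio\<close> over an arc and inserting the constant 17
  for the square root of the chord gives \<open>1 - s\<^sup>2 + 17 * s\<^sup>2\<close>.\<close>

lemma A2_characteristic_power_weight:
  assumes c: "0 < c" and s: "0 < s" "s \<le> 1"
  shows "A2_characteristic (power_weight c (s / 2)) \<le> ennreal (1 + 16 * s\<^sup>2)"
  unfolding A2_characteristic_def
proof (rule SUP_least, clarify)
  fix a b :: real assume ab: "a < b" "b \<le> a + 2 * pi"
  let ?M = "lebesgue_on {a..b}"
  let ?u = "\<lambda>\<theta>. ennreal (power_weight c (s / 2) (cis \<theta>))" and ?v = "\<lambda>\<theta>. ennreal (sqrt (cmod (cis \<theta> - 1)))"
  let ?P = "integral\<^sup>N ?M ?u * (\<integral>\<^sup>+\<theta>. inverse (?u \<theta>) \<partial>?M)"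
  have s1: "s\<^sup>2 \<le> 1" using s by (simp add: power_le_one)
  have [measurable]: "?u \<in> borel_measurable ?M" "?v \<in> borel_measurable ?M"
    unfolding power_weight_def by (intro borel_imp_lebesgue_on; measurable)+
  have "2 * ?P \<le> ennreal (2 * (1 - s\<^sup>2)) * emeasure ?M (space ?M) * emeasure ?M (space ?M) +
       ennreal (s\<^sup>2) * (2 * (integral\<^sup>N ?M ?v * (\<integral>\<^sup>+\<theta>. inverse (?v \<theta>) \<partial>?M)))"
    by (rule nn_integral_product_le) (measurable, rule power_weight_ratio[OF assms])
  also have "\<dots> \<le> ennreal (2 * (1 - s\<^sup>2)) * ennreal (b - a) * ennreal (b - a) +
       ennreal (s\<^sup>2) * (2 * ennreal (17 * (b - a)\<^sup>2))"
    unfolding emeasure_lebesgue_on_interval[OF less_imp_le[OF ab(1)]]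
    using ab by (intro add_mono mult_left_mono sqrt_chord_A2_bound) auto
  also have "\<dots> = ennreal (2 * (1 - s\<^sup>2)) * ennreal (b - a) * ennreal (b - a) +
       ennreal (s\<^sup>2) * (ennreal 2 * ennreal (17 * (b - a)\<^sup>2))" by simp
  also have "\<dots> = ennreal (2 * (1 - s\<^sup>2) * (b - a) * (b - a) + s\<^sup>2 * (2 * (17 * (b - a)\<^sup>2)))"
    using ab s1 by (simp add: ennreal_mult[symmetric] ennreal_plus[symmetric] del: ennreal_plus ennreal_numeral)
  also have "\<dots> = 2 * ennreal ((1 + 16 * s\<^sup>2) * (b - a)\<^sup>2)"
  proof -
    have "2 * (1 - s\<^sup>2) * (b - a) * (b - a) + s\<^sup>2 * (2 * (17 * (b - a)\<^sup>2)) = 2 * ((1 + 16 * s\<^sup>2) * (b - a)\<^sup>2)"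
      by (simp add: algebra_simps power2_eq_square)
    then show ?thesis by (simp only: ennreal_mult') simp
  qed
  finally have P: "?P \<le> ennreal ((1 + 16 * s\<^sup>2) * (b - a)\<^sup>2)"
    by (subst (asm) ennreal_mult_le_mult_iff) auto
  have "arc_average (\<lambda>z. ennreal (power_weight c (s / 2) z)) a b *
       arc_average (\<lambda>z. inverse (ennreal (power_weight c (s / 2) z))) a b =
       ?P * (inverse (ennreal (b - a)) * inverse (ennreal (b - a)))"
    unfolding arc_average_def divide_ennreal_def
    by (simp add: nn_integral_restrict_space mult_ac)
  also have "\<dots> \<le> ennreal ((1 + 16 * s\<^sup>2) * (b - a)\<^sup>2) * (inverse (ennreal (b - a)) * inverse (ennreal (b - a)))"
    by (intro mult_right_mono P) simp
  also have "\<dots> = ennreal (1 + 16 * s\<^sup>2)"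
  proof -
    have "K * L\<^sup>2 * (inverse L * inverse L) = K" if "0 < L" for K L :: real
      using that by (simp add: field_simps power2_eq_square)
    from this[of "b - a"]
    have "(1 + 16 * s\<^sup>2) * (b - a)\<^sup>2 * (inverse (b - a) * inverse (b - a)) = 1 + 16 * s\<^sup>2"
      using ab by simp
    then show ?thesis
      using ab by (simp add: inverse_ennreal ennreal_mult[symmetric] del: ennreal_plus)
  qed
  finally show "arc_average (\<lambda>z. ennreal (power_weight c (s / 2) z)) a b *
       arc_average (\<lambda>z. inverse (ennreal (power_weight c (s / 2) z))) a b \<le> ennreal (1 + 16 * s\<^sup>2)" .
qed

section \<open>Fourier coefficients on the unweighted circle\<close>

text \<open>It makes all facts about weighted inner products available for normalized arc
  length.\<close>

lemma normalized_weight_one: "normalized_weight (\<lambda>_. 1)"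
proof -
  have "(\<integral>\<^sup>+\<theta>\<in>{0..2*pi}. ennreal (1 / (2*pi)) \<partial>lebesgue) = ennreal (1 / (2*pi)) * ennreal (2 * pi)"
    by (simp add: nn_integral_cmult_indicator)
  then show ?thesis unfolding normalized_weight_def by (simp add: ennreal_mult[symmetric])
qed

abbreviation circle_measure :: "real measure" where
  "circle_measure \<equiv> weight_measure (\<lambda>_. 1)"

lemma sets_circle_measure [measurable_cong]: "sets circle_measure = sets (lebesgue_on {0..2*pi})"
  by (simp add: weight_measure_def)

lemma weight_measure_density:
  assumes "normalized_weight w"
  shows "weight_measure w = density circle_measure (\<lambda>\<theta>. ennreal (w (cis \<theta>)))"
proof -
  have [measurable]: "(\<lambda>\<theta>. w (cis \<theta>)) \<in> borel_measurable (lebesgue_on {0..2*pi})"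
    using assms unfolding normalized_weight_def by (intro measurable_restrict_space1) auto
  show ?thesis
    using assms unfolding weight_measure_def normalized_weight_def
    by (simp add: density_density_eq ennreal_mult[symmetric])
qed

lemma weight_measurable_circle:
  assumes "normalized_weight w"
  shows "(\<lambda>\<theta>. w (cis \<theta>)) \<in> borel_measurable circle_measure"
proof -
  have "(\<lambda>\<theta>. w (cis \<theta>)) \<in> borel_measurable (lebesgue_on {0..2*pi})"
    using assms unfolding normalized_weight_def by (intro measurable_restrict_space1) auto
  then show ?thesis by (simp add: measurable_def sets_circle_measure weight_measure_def)
qed

lemma circle_integral_power:
  assumes "k \<noteq> (0::int)"
  shows "(LINT \<theta>|lebesgue_on {0..2*pi}. cis (of_int k * \<theta>)) = 0"
proof -
  \<comment> \<open>An antiderivative with period \<open>2 * pi\<close>; the division is where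
    \<open>k \<noteq> 0\<close> enters.\<close>
  let ?F = "\<lambda>z. exp (\<i> * of_int k * z) / (\<i> * of_int k)"
  have "((\<lambda>\<theta>. cis (of_int k * \<theta>)) has_integral (?F (of_real (2*pi)) - ?F (of_real 0))) {0..2*pi}"
  proof (rule fundamental_theorem_of_calculus)
    fix \<theta> :: real
    have "(?F has_field_derivative exp (\<i> * of_int k * of_real \<theta>)) (at (of_real \<theta>))"
      using assms by (auto intro!: derivative_eq_intros)
    from has_vector_derivative_real_field[OF this]
    show "((\<lambda>\<theta>. ?F (of_real \<theta>)) has_vector_derivative cis (of_int k * \<theta>)) (at \<theta> within {0..2*pi})"
      by (simp add: cis_conv_exp mult_ac has_vector_derivative_at_within)
  qed simp
  moreover have "exp (\<i> * of_int k * of_real (2*pi)) = 1"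
    using cis_multiple_2pi[of "of_int k"] by (simp add: cis_conv_exp mult_ac)
  ultimately have "((\<lambda>\<theta>. cis (of_int k * \<theta>)) has_integral 0) {0..2*pi}" by simp
  moreover have "integrable (lebesgue_on {0..2*pi}) (\<lambda>\<theta>. cis (of_int k * \<theta>))"
    by (intro continuous_imp_integrable_real continuous_intros)
  ultimately show ?thesis
    by (simp add: lebesgue_integral_eq_integral integral_unique)
qed

lemma circle_inner_monom:
  "weighted_inner (\<lambda>_. 1) (poly (monom 1 i)) (poly (monom 1 j)) = (if i = j then 1 else 0)"
proof -
  have "weighted_inner (\<lambda>_. 1) (poly (monom 1 i)) (poly (monom 1 j)) =
     (LINT \<theta>|circle_measure. cis (of_int (int i - int j) * \<theta>))"
    unfolding weighted_inner_def
    by (simp add: poly_monom Complex.DeMoivre cis_cnj cis_mult left_diff_distrib del: cis_divide)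
  also have "\<dots> = (if i = j then 1 else 0)"
  proof (cases "i = j")
    case True
    then show ?thesis
      using emeasure_weight_measure[OF normalized_weight_one] by (simp add: measure_def)
  next
    case False
    have [measurable]: "(\<lambda>\<theta>. cis ((real i - real j) * \<theta>)) \<in> borel_measurable (lebesgue_on {0..2*pi})"
      by (intro borel_imp_lebesgue_on borel_measurable_continuous_onI continuous_intros)
    show ?thesis unfolding weight_measure_def
      using circle_integral_power[of "int i - int j"] False
      by (subst integral_density) simp_all
  qed
  finally show ?thesis .
qed

lemma circle_inner_coeff:
  "weighted_inner (\<lambda>_. 1) (poly p) (poly (monom 1 j)) = coeff p j"
proof -
  have "p = (\<Sum>i\<le>degree p. smult (coeff p i) (monom 1 i))"
    by (simp add: smult_monom poly_as_sum_of_monoms)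
  then have "weighted_inner (\<lambda>_. 1) (poly p) (poly (monom 1 j)) =
    (\<Sum>i\<le>degree p. coeff p i * (if i = j then 1 else 0))"
    using ip_sum[OF normalized_weight_one, of "\<lambda>i. smult (coeff p i) (monom 1 i)" "{..degree p}" "monom 1 j"]
    by (simp only: ip_smult[OF normalized_weight_one] circle_inner_monom)
  also have "\<dots> = coeff p j"
    by (simp add: if_distrib[of "(*) _"] sum.delta coeff_eq_0 cong: if_cong)
  finally show ?thesis .
qed

lemma integrable_weight_continuous:
  fixes f :: "complex \<Rightarrow> real"
  assumes "normalized_weight w" "continuous_on UNIV f"
  shows "integrable (weight_measure w) (\<lambda>\<theta>. f (cis \<theta>))"
proof -
  interpret finite_measure "weight_measure w" by (rule finite_measure_weight[OF assms(1)])
  have "compact (f ` sphere 0 1)"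
    by (intro compact_continuous_image continuous_on_subset[OF assms(2)]) auto
  then have "bounded (f ` sphere 0 1)" by (rule compact_imp_bounded)
  then obtain B where "\<And>z. z \<in> sphere 0 1 \<Longrightarrow> norm (f z) \<le> B"
    unfolding bounded_iff by blast
  moreover have "(\<lambda>\<theta>. f (cis \<theta>)) \<in> borel_measurable (weight_measure w)"
  proof -
    have "continuous_on UNIV (\<lambda>\<theta>. f (cis \<theta>))"
      by (intro continuous_on_compose2[OF assms(2)] continuous_intros) auto
    then have "(\<lambda>\<theta>. f (cis \<theta>)) \<in> borel_measurable (lebesgue_on {0..2*pi})"
      by (intro borel_imp_lebesgue_on borel_measurable_continuous_onI)
    then show ?thesis by (simp add: weight_measure_def measurable_def)
  qed
  ultimately show ?thesis by (intro integrable_const_bound[of _ B]) auto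
qed

text \<open>Every coefficient is a Fourier coefficient and so at most the \<open>L\<^sup>1\<close>
  norm; the value at 1 is the sum of \<open>degree q + 1\<close> coefficients.\<close>

lemma poly_one_le_circle_L1:
  "cmod (poly q 1) \<le> (real (degree q) + 1) * (LINT \<theta>|circle_measure. cmod (poly q (cis \<theta>)))"
proof -
  have c: "cmod (coeff q j) \<le> (LINT \<theta>|circle_measure. cmod (poly q (cis \<theta>)))" for j
  proof -
    have "cmod (coeff q j) \<le> (LINT \<theta>|circle_measure. cmod (poly q (cis \<theta>) * cnj (poly (monom 1 j) (cis \<theta>))))"
      unfolding circle_inner_coeff[symmetric] weighted_inner_def by (rule integral_norm_bound)
    also have "\<dots> = (LINT \<theta>|circle_measure. cmod (poly q (cis \<theta>)))"
      by (simp add: norm_mult poly_monom norm_power)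
    finally show ?thesis .
  qed
  have "cmod (poly q 1) = cmod (\<Sum>j\<le>degree q. coeff q j)" by (simp add: poly_altdef)
  also have "\<dots> \<le> (\<Sum>j\<le>degree q. cmod (coeff q j))" by (rule norm_sum)
  also have "\<dots> \<le> of_nat (card {..degree q}) * (LINT \<theta>|circle_measure. cmod (poly q (cis \<theta>)))"
    by (intro sum_bounded_above c)
  finally show ?thesis by (simp add: algebra_simps)
qed

section \<open>The extremal property of the reproducing kernel\<close>

text \<open>Expand \<open>p\<close> in the orthonormal polynomials of degree below \<open>N\<close>,
  then combine Parseval's identity with the Cauchy-Schwarz inequality.\<close>

lemma norm_poly_squared_le_kernel:
  assumes w: "normalized_weight w" and \<phi>: "orthonormal_polys w \<phi>" and p: "degree p < N"
  shows "(cmod (poly p z))\<^sup>2 \<le>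
     (\<Sum>k<N. (cmod (poly (\<phi> k) z))\<^sup>2) * (LINT \<theta>|weight_measure w. (cmod (poly p (cis \<theta>)))\<^sup>2)"
proof -
  let ?ip = "\<lambda>p q. weighted_inner w (poly p) (poly q)"
  have deg: "degree (\<phi> k) = k" and nz: "\<phi> k \<noteq> 0" for k
    using \<phi> unfolding orthonormal_polys_def by (auto, metis less_irrefl zero_complex.simps(1) coeff_0)
  have ort: "?ip (\<phi> k) (\<phi> l) = (if k = l then 1 else 0)" for k l
    using \<phi> unfolding orthonormal_polys_def by blast
  define c where "c k = ?ip p (\<phi> k)" for k
  define s where "s = (\<Sum>k<N. smult (c k) (\<phi> k))"
  have "?ip s (\<phi> k) = c k" if "k < N" for k
    using that unfolding s_def
    by (simp add: ip_sum[OF w] ip_smult[OF w] ort if_distrib[of "(*) _"] sum.delta cong: if_cong)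
  then have orth: "?ip (\<phi> k) (p - s) = 0" if "k < N" for k
    using that ip_cnj[OF w, of "\<phi> k" "p - s"] ip_diff[OF w, of p s "\<phi> k"] by (simp add: c_def)
  have "degree s < N" unfolding s_def
    using p by (intro degree_sum_less) (auto intro: le_less_trans[OF degree_smult_le] simp: deg)
  then have "degree (p - s) < N" using p by (rule degree_diff_less[rotated])
  \<comment> \<open>The difference has degree below \<open>N\<close> and is orthogonal to every
    \<open>\<phi> k\<close> with \<open>k < N\<close>, hence to itself.\<close>
  then have "?ip (p - s) (p - s) = 0"
    using lower_degree_orthogonal[OF w, of \<phi> N "p - s" "p - s"] deg nz orth by blast
  then have ps: "p = s" using ip_self_eq_0[OF w] by fastforce
  have "?ip p p = (\<Sum>k<N. c k * ?ip (\<phi> k) p)"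
    by (subst (1) ps) (simp only: s_def ip_sum[OF w] ip_smult[OF w])
  also have "\<dots> = (\<Sum>k<N. c k * cnj (c k))"
    unfolding c_def using ip_cnj[OF w, of _ p] by (metis (no_types))
  also have "\<dots> = of_real (\<Sum>k<N. (cmod (c k))\<^sup>2)"
    by (simp only: complex_norm_square of_real_sum)
  finally have norm: "(LINT \<theta>|weight_measure w. (cmod (poly p (cis \<theta>)))\<^sup>2) = (\<Sum>k<N. (cmod (c k))\<^sup>2)"
    unfolding ip_self[OF w] of_real_eq_iff .
  have "cmod (poly p z) = cmod (\<Sum>k<N. c k * poly (\<phi> k) z)"
    by (subst ps) (simp add: s_def poly_sum)
  also have "\<dots> \<le> (\<Sum>k<N. cmod (poly (\<phi> k) z) * cmod (c k))"
    by (rule sum_norm_le) (simp add: norm_mult)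
  finally have "(cmod (poly p z))\<^sup>2 \<le> (\<Sum>k<N. cmod (poly (\<phi> k) z) * cmod (c k))\<^sup>2"
    by (intro power_mono) auto
  also have "\<dots> \<le> (\<Sum>k<N. (cmod (poly (\<phi> k) z))\<^sup>2) * (\<Sum>k<N. (cmod (c k))\<^sup>2)"
    by (rule Cauchy_Schwarz_ineq_sum)
  finally show ?thesis unfolding norm .
qed

section \<open>The Dirichlet polynomial and its weighted norm\<close>

definition dirichlet_poly :: "nat \<Rightarrow> complex poly" where
  "dirichlet_poly N = (\<Sum>i<N. monom 1 i)"

lemma coeff_dirichlet_poly: "coeff (dirichlet_poly N) j = (if j < N then 1 else 0)"
  by (auto simp: dirichlet_poly_def coeff_sum)

lemma degree_dirichlet_poly: "0 < N \<Longrightarrow> degree (dirichlet_poly N) < N"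
  unfolding dirichlet_poly_def
  by (intro degree_sum_less) (auto intro: le_less_trans[OF degree_monom_le])

lemma poly_dirichlet_poly: "poly (dirichlet_poly N) z = (\<Sum>i<N. z ^ i)"
  by (simp add: dirichlet_poly_def poly_sum poly_monom)

lemma dirichlet_poly_L2: "(LINT \<theta>|circle_measure. (cmod (poly (dirichlet_poly N) (cis \<theta>)))\<^sup>2) = real N"
proof -
  let ?D = "dirichlet_poly N"
  have "weighted_inner (\<lambda>_. 1) (poly ?D) (poly ?D) =
      (\<Sum>i<N. weighted_inner (\<lambda>_. 1) (poly (monom 1 i)) (poly ?D))"
    by (subst (1) dirichlet_poly_def) (rule ip_sum[OF normalized_weight_one])
  also have "\<dots> = (\<Sum>i<N. 1)"
    by (rule sum.cong[OF refl], subst ip_cnj[OF normalized_weight_one])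
      (simp add: circle_inner_coeff coeff_dirichlet_poly)
  finally have "complex_of_real (LINT \<theta>|circle_measure. (cmod (poly ?D (cis \<theta>)))\<^sup>2) = of_real (real N)"
    unfolding ip_self[OF normalized_weight_one] by simp
  then show ?thesis unfolding of_real_eq_iff .
qed

text \<open>By the geometric sum the product is \<open>cmod (z ^ N - 1)\<close>.\<close>

lemma dirichlet_poly_chord:
  assumes "cmod z = 1"
  shows "cmod (poly (dirichlet_poly N) z) * cmod (z - 1) \<le> 2"
proof -
  have "cmod (poly (dirichlet_poly N) z) * cmod (z - 1) = cmod (z ^ N - 1)"
    by (simp add: poly_dirichlet_poly power_diff_1_eq norm_mult)
  also have "\<dots> \<le> cmod (z ^ N) + cmod 1" by (rule norm_triangle_ineq4)
  finally show ?thesis using assms by (simp add: norm_power)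
qed

text \<open>The circle is split at chord length \<open>N powr (- 1 / 2)\<close>. Closer to 1 the
  factor \<open>cmod (z - 1) powr \<alpha>\<close> is small; farther away
  \<open>dirichlet_poly_chord\<close> leaves the nonpositive power \<open>\<alpha> - 2\<close> of
  the chord. As the unweighted squared norm is \<open>N\<close>, both terms integrate to order
  \<open>N powr (1 - \<alpha> / 2)\<close>.\<close>

lemma dirichlet_poly_weighted_le:
  assumes "cmod z = 1" "0 < N" "0 \<le> \<alpha>" "\<alpha> \<le> 2"
  shows "(cmod (poly (dirichlet_poly N) z))\<^sup>2 * cmod (z - 1) powr \<alpha> \<le>
     real N powr (- \<alpha> / 2) * (cmod (poly (dirichlet_poly N) z))\<^sup>2 + 4 * real N powr (1 - \<alpha> / 2)"
proof -
  let ?x = "cmod (poly (dirichlet_poly N) z)" and ?g = "cmod (z - 1)"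
  show ?thesis
  proof (cases "?g \<le> real N powr (- 1 / 2)")
    case True
    then have "?g powr \<alpha> \<le> (real N powr (- 1 / 2)) powr \<alpha>" using assms by (intro powr_mono2) auto
    also have "\<dots> = real N powr (- \<alpha> / 2)" by (simp add: powr_powr)
    finally have "?x\<^sup>2 * ?g powr \<alpha> \<le> ?x\<^sup>2 * real N powr (- \<alpha> / 2)" by (intro mult_left_mono) auto
    then show ?thesis by (simp add: mult.commute add_increasing2)
  next
    case False
    have N: "0 < real N powr (- 1 / 2)" using assms by simp
    with False have g: "0 < ?g" by linarith
    have "?x\<^sup>2 * ?g powr \<alpha> = (?x * ?g)\<^sup>2 * ?g powr (\<alpha> - 2)"
      using g by (simp add: powr_diff power_mult_distrib)
    also have "\<dots> \<le> 2\<^sup>2 * ?g powr (\<alpha> - 2)"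
      using dirichlet_poly_chord[OF assms(1)] by (intro mult_right_mono power_mono) auto
    also have "?g powr (\<alpha> - 2) \<le> (real N powr (- 1 / 2)) powr (\<alpha> - 2)"
      using False N assms by (intro powr_mono2') auto
    also have "\<dots> = real N powr (1 - \<alpha> / 2)"
    proof -
      have "- 1 / 2 * (\<alpha> - 2) = 1 - \<alpha> / 2" by (simp add: field_simps)
      then show ?thesis by (simp only: powr_powr)
    qed
    finally show ?thesis by (simp add: add_increasing)
  qed
qed

lemma dirichlet_poly_weighted_L2:
  assumes w: "normalized_weight (power_weight c \<alpha>)" and "0 < c" "0 < N" "0 \<le> \<alpha>" "\<alpha> \<le> 2"
  shows "(LINT \<theta>|weight_measure (power_weight c \<alpha>). (cmod (poly (dirichlet_poly N) (cis \<theta>)))\<^sup>2) \<le>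
    5 * c * real N powr (1 - \<alpha> / 2)"
proof -
  let ?w = "power_weight c \<alpha>" and ?D = "\<lambda>\<theta>. (cmod (poly (dirichlet_poly N) (cis \<theta>)))\<^sup>2"
  have w0: "0 \<le> ?w z" for z using assms by (simp add: power_weight_def)
  note [measurable] = weight_measurable_circle[OF w]
  have iD: "integrable circle_measure ?D" by (rule integrable_sq[OF normalized_weight_one])
  then have [measurable]: "?D \<in> borel_measurable circle_measure" by (rule borel_measurable_integrable)
  interpret finite_measure circle_measure by (rule finite_measure_weight[OF normalized_weight_one])
  have "measure circle_measure (space circle_measure) = 1"
    using emeasure_weight_measure[OF normalized_weight_one] by (simp add: measure_def)
  have iw: "integrable circle_measure (\<lambda>\<theta>. ?w (cis \<theta>) * ?D \<theta>)"
    using integrable_sq[OF w, of "dirichlet_poly N"] w0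
    unfolding weight_measure_density[OF w] by (subst (asm) integrable_density) auto
  have "(LINT \<theta>|weight_measure ?w. ?D \<theta>) = (LINT \<theta>|circle_measure. ?w (cis \<theta>) * ?D \<theta>)"
    using w0 unfolding weight_measure_density[OF w] by (subst integral_density) auto
  also have "\<dots> \<le> (LINT \<theta>|circle_measure. c * real N powr (- \<alpha> / 2) * ?D \<theta> + c * (4 * real N powr (1 - \<alpha> / 2)))"
  proof (rule integral_mono[OF iw])
    fix \<theta>
    have "c * (?D \<theta> * cmod (cis \<theta> - 1) powr \<alpha>) \<le>
       c * (real N powr (- \<alpha> / 2) * ?D \<theta> + 4 * real N powr (1 - \<alpha> / 2))"
      using assms by (intro mult_left_mono dirichlet_poly_weighted_le) auto
    then show "?w (cis \<theta>) * ?D \<theta> \<le> c * real N powr (- \<alpha> / 2) * ?D \<theta> + c * (4 * real N powr (1 - \<alpha> / 2))"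
      by (simp add: power_weight_def algebra_simps)
  qed (use iD in auto)
  also have "\<dots> = c * real N powr (- \<alpha> / 2) * real N + c * (4 * real N powr (1 - \<alpha> / 2))"
    using iD \<open>measure circle_measure (space circle_measure) = 1\<close> by (simp add: dirichlet_poly_L2)
  also have "c * real N powr (- \<alpha> / 2) * real N = c * real N powr (1 - \<alpha> / 2)"
    using assms powr_add[of "real N" "- \<alpha> / 2" 1] by simp
  finally show ?thesis by simp
qed

section \<open>Normalization of the power weights\<close>

lemma normalized_power_weight_exists:
  assumes "0 \<le> \<alpha>"
  shows "\<exists>c>0. normalized_weight (power_weight c \<alpha>)"
proof -
  let ?g = "\<lambda>\<theta>. cmod (cis \<theta> - 1) powr \<alpha> / (2 * pi)"
  define J where "J = (\<integral>\<^sup>+\<theta>\<in>{0..2*pi}. ennreal (?g \<theta>) \<partial>lebesgue)"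
  have gm: "?g \<in> borel_measurable lebesgue"
    by (intro measurable_completion) simp
  have wm: "(\<lambda>\<theta>. power_weight c \<alpha> (cis \<theta>)) \<in> borel_measurable lebesgue" for c
    unfolding power_weight_def by (intro measurable_completion) simp
  have "J \<le> (\<integral>\<^sup>+\<theta>\<in>{0..2*pi}. ennreal (2 powr \<alpha> / (2 * pi)) \<partial>lebesgue)"
    unfolding J_def
  proof (intro nn_integral_mono mult_right_mono ennreal_leI divide_right_mono powr_mono2)
    show "cmod (cis \<theta> - 1) \<le> 2" for \<theta>
      using norm_triangle_ineq4[of "cis \<theta>" 1] by simp
  qed (use assms in auto)
  also have "\<dots> = ennreal (2 powr \<alpha> / (2 * pi)) * ennreal (2 * pi)"
    by (simp add: nn_integral_cmult_indicator)
  also have "\<dots> < top" by (simp add: ennreal_mult_less_top)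
  finally have J_fin: "J < top" .
  \<comment> \<open>On this quarter of the circle the chord is at least 1, which keeps
    \<open>J\<close> away from 0.\<close>
  have "ennreal (1 / (2 * pi)) * ennreal (pi / 2) = (\<integral>\<^sup>+\<theta>\<in>{pi/2..pi}. ennreal (1 / (2 * pi)) \<partial>lebesgue)"
    by (simp add: nn_integral_cmult_indicator)
  also have "\<dots> \<le> J"
    unfolding J_def
  proof (intro nn_integral_mono)
    fix \<theta> :: real
    show "ennreal (1 / (2 * pi)) * indicator {pi/2..pi} \<theta> \<le> ennreal (?g \<theta>) * indicator {0..2*pi} \<theta>"
    proof (cases "\<theta> \<in> {pi/2..pi}")
      case True
      then have "1 \<le> 2 * \<bar>\<theta>\<bar> / pi" "\<bar>\<theta>\<bar> \<le> pi" by (auto simp: field_simps)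
      then have "1 \<le> cmod (cis \<theta> - 1)" using chord_ge[of \<theta>] by linarith
      then have "1 \<le> cmod (cis \<theta> - 1) powr \<alpha>" using assms by (rule ge_one_powr_ge_zero)
      then show ?thesis using True pi_gt_zero by (auto intro!: ennreal_leI divide_right_mono)
    qed simp
  qed
  finally have J_pos: "0 < J"
    by (rule less_le_trans[rotated]) (simp add: ennreal_zero_less_mult_iff)
  define c where "c = inverse (enn2real J)"
  have c: "0 < c" using J_pos J_fin by (simp add: c_def enn2real_positive_iff)
  have "(\<integral>\<^sup>+\<theta>\<in>{0..2*pi}. ennreal (power_weight c \<alpha> (cis \<theta>) / (2 * pi)) \<partial>lebesgue) =
     (\<integral>\<^sup>+\<theta>. ennreal c * (ennreal (?g \<theta>) * indicator {0..2*pi} \<theta>) \<partial>lebesgue)"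
    using c by (intro nn_integral_cong) (simp add: power_weight_def ennreal_mult[symmetric] mult.assoc[symmetric])
  also have "\<dots> = ennreal c * J" unfolding J_def
    by (intro nn_integral_cmult borel_measurable_times_ennreal measurable_compose[OF gm measurable_ennreal]
        borel_measurable_indicator) auto
  also have "J = ennreal (enn2real J)" using J_fin by simp
  also have "ennreal c * \<dots> = 1" using c by (simp add: c_def ennreal_mult[symmetric])
  finally have "normalized_weight (power_weight c \<alpha>)"
    unfolding normalized_weight_def using c wm by (simp add: power_weight_def)
  then show ?thesis using c by blast
qed

section \<open>Point values controlled by weighted \<open>L\<^sup>p\<close> norms\<close>

text \<open>The characteristic is tested on the full circle, where the average of \<open>w\<close>
  is 1 by normalization.\<close>

lemma nn_integral_inverse_weight_le_A2:
  assumes w: "normalized_weight w" and t: "A2_characteristic w \<le> t"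
  shows "(\<integral>\<^sup>+\<theta>. inverse (ennreal (w (cis \<theta>))) \<partial>circle_measure) \<le> t"
proof -
  have [measurable]: "(\<lambda>\<theta>. w (cis \<theta>)) \<in> borel_measurable (lebesgue_on {0..2*pi})"
    using w unfolding normalized_weight_def by (intro measurable_restrict_space1) auto
  have avg: "(\<integral>\<^sup>+\<theta>. f (cis \<theta>) \<partial>circle_measure) = arc_average f 0 (2*pi)"
    if [measurable]: "(\<lambda>\<theta>. f (cis \<theta>)) \<in> borel_measurable (lebesgue_on {0..2*pi})" for f
    unfolding weight_measure_def arc_average_def
    by (subst nn_integral_density, measurable)
      (simp add: nn_integral_cmult nn_integral_restrict_space[symmetric] divide_ennreal_def
      inverse_ennreal inverse_eq_divide, rule mult.commute)
  have avg_w: "(\<integral>\<^sup>+\<theta>. ennreal (w (cis \<theta>)) \<partial>circle_measure) = arc_average (\<lambda>z. ennreal (w z)) 0 (2*pi)"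
    and avg_inv: "(\<integral>\<^sup>+\<theta>. inverse (ennreal (w (cis \<theta>))) \<partial>circle_measure) =
      arc_average (\<lambda>z. inverse (ennreal (w z))) 0 (2*pi)"
    by (rule avg; measurable)+
  have "(\<integral>\<^sup>+\<theta>. ennreal (w (cis \<theta>)) \<partial>circle_measure) = 1"
    using emeasure_weight_measure[OF w] weight_measurable_circle[OF w]
    unfolding weight_measure_density[OF w] by (subst (asm) emeasure_density) (auto simp: indicator_def cong: nn_integral_cong)
  then have 1: "arc_average (\<lambda>z. ennreal (w z)) 0 (2*pi) = 1" unfolding avg_w .
  have "arc_average (\<lambda>z. ennreal (w z)) 0 (2*pi) * arc_average (\<lambda>z. inverse (ennreal (w z))) 0 (2*pi)
     \<le> A2_characteristic w"
    unfolding A2_characteristic_def by (rule SUP_upper2[of "(0, 2*pi)"]) auto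
  then show ?thesis using t 1 by (simp add: avg_inv)
qed

text \<open>Apply \<open>poly_one_le_circle_L1\<close> to \<open>q ^ m\<close>. The unweighted
  integral of \<open>\<bar>q\<bar> ^ m\<close> is at most the integral of
  \<open>w * \<bar>q\<bar> ^ (2 * m)\<close> plus that of \<open>1 / w\<close>. The second is at
  most \<open>t\<close>, and the first is at most 1 plus the weighted integral of
  \<open>\<bar>q\<bar> powr p\<close>, because \<open>2 * m \<le> p\<close> and the weighted measure
  has mass 1.\<close>

lemma power_poly_one_le:
  assumes w: "normalized_weight w" and t: "A2_characteristic w \<le> ennreal t" "0 \<le> t"
    and p: "0 < p" "2 * real m \<le> p"
  shows "cmod (poly q 1) ^ m \<le> (real m * real (degree q) + 1) *
     (1 + (LINT \<theta>|weight_measure w. cmod (poly q (cis \<theta>)) powr p) + t)"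
proof -
  let ?x = "\<lambda>\<theta>. cmod (poly q (cis \<theta>))"
  note [measurable] = weight_measurable_circle[OF w]
  interpret finite_measure "weight_measure w" by (rule finite_measure_weight[OF w])
  define X where "X = (LINT \<theta>|weight_measure w. ?x \<theta> powr p)"
  have X0: "0 \<le> X" unfolding X_def by simp
  have iX: "integrable (weight_measure w) (\<lambda>\<theta>. ?x \<theta> powr p)"
    using p
    by (intro integrable_weight_continuous[OF w, where f = "\<lambda>z. cmod (poly q z) powr p"]
        continuous_on_powr' continuous_intros) auto
  have im: "integrable circle_measure (\<lambda>\<theta>. ?x \<theta> ^ k)" for k
    by (intro integrable_weight_continuous[OF normalized_weight_one, where f = "\<lambda>z. cmod (poly q z) ^ k"]
        continuous_intros)
  note [measurable] = borel_measurable_integrable[OF im]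
  have "ennreal (LINT \<theta>|circle_measure. ?x \<theta> ^ m) = (\<integral>\<^sup>+\<theta>. ennreal (?x \<theta> ^ m) \<partial>circle_measure)"
    by (rule nn_integral_eq_integral[symmetric]) (use im in auto)
  also have "\<dots> \<le> (\<integral>\<^sup>+\<theta>. ennreal (w (cis \<theta>)) * ennreal (?x \<theta> ^ (2 * m)) + inverse (ennreal (w (cis \<theta>))) \<partial>circle_measure)"
  proof (rule nn_integral_mono)
    fix \<theta>
    let ?u = "w (cis \<theta>)" and ?y = "?x \<theta> ^ m"
    have y: "?x \<theta> ^ (2 * m) = ?y * ?y" by (simp add: mult_2 power_add)
    have u0: "0 \<le> ?u" using w by (simp add: normalized_weight_def)
    show "ennreal ?y \<le> ennreal ?u * ennreal (?x \<theta> ^ (2 * m)) + inverse (ennreal ?u)"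
    \<comment> \<open>Either \<open>u * y \<ge> 1\<close>, and then
      \<open>y \<le> u * y\<^sup>2\<close>, or \<open>y\<close> is below \<open>1 / u\<close>, which
      is infinite for \<open>u = 0\<close>.\<close>
    proof (cases "1 \<le> ?u * ?y")
      case True
      then have "?y \<le> ?u * (?y * ?y)" using mult_right_mono[OF True, of ?y] by (simp add: mult_ac)
      then have "ennreal ?y \<le> ennreal ?u * ennreal (?x \<theta> ^ (2 * m))"
        unfolding y using u0 by (simp add: ennreal_mult[symmetric])
      then show ?thesis by (rule add_increasing2[rotated]) simp
    next
      case False
      have "ennreal ?y \<le> inverse (ennreal ?u)"
      proof (cases "?u = 0")
        case False
        then have "0 < ?u" using u0 by simp
        then show ?thesis using \<open>\<not> 1 \<le> ?u * ?y\<close> by (simp add: inverse_ennreal field_simps)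
      qed simp
      then show ?thesis by (rule add_increasing[rotated]) simp
    qed
  qed
  also have "\<dots> = (\<integral>\<^sup>+\<theta>. ennreal (?x \<theta> ^ (2 * m)) \<partial>weight_measure w) +
      (\<integral>\<^sup>+\<theta>. inverse (ennreal (w (cis \<theta>))) \<partial>circle_measure)"
    unfolding weight_measure_density[OF w] by (simp add: nn_integral_density nn_integral_add)
  also have "\<dots> \<le> ennreal (1 + X) + ennreal t"
  proof (intro add_mono order_trans[OF nn_integral_inverse_weight_le_A2[OF w t(1)]])
    have "(\<integral>\<^sup>+\<theta>. ennreal (?x \<theta> ^ (2 * m)) \<partial>weight_measure w) \<le>
        (\<integral>\<^sup>+\<theta>. ennreal (1 + ?x \<theta> powr p) \<partial>weight_measure w)"
    proof (intro nn_integral_mono ennreal_leI)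
      fix \<theta>
      show "?x \<theta> ^ (2 * m) \<le> 1 + ?x \<theta> powr p"
      proof (cases "?x \<theta> \<le> 1")
        case True
        then show ?thesis by (intro add_increasing2 power_le_one) auto
      next
        case False
        then have "0 < ?x \<theta>" by linarith
        then have "?x \<theta> ^ (2 * m) = ?x \<theta> powr real (2 * m)" by (rule powr_realpow[symmetric])
        also have "\<dots> \<le> ?x \<theta> powr p" using False p by (intro powr_mono) auto
        finally show ?thesis by simp
      qed
    qed
    also have "\<dots> = ennreal (LINT \<theta>|weight_measure w. 1 + ?x \<theta> powr p)"
      by (rule nn_integral_eq_integral) (use iX in auto)
    also have "(LINT \<theta>|weight_measure w. 1 + ?x \<theta> powr p) = 1 + X"
      using iX emeasure_weight_measure[OF w] by (simp add: X_def measure_def)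
    finally show "(\<integral>\<^sup>+\<theta>. ennreal (?x \<theta> ^ (2 * m)) \<partial>weight_measure w) \<le> ennreal (1 + X)" .
  qed simp
  also have "\<dots> = ennreal (1 + X + t)" using X0 t by (simp add: ennreal_plus[symmetric] del: ennreal_plus)
  finally have I: "(LINT \<theta>|circle_measure. ?x \<theta> ^ m) \<le> 1 + X + t"
    using X0 t by (subst (asm) ennreal_le_iff) auto
  have "cmod (poly q 1) ^ m = cmod (poly (q ^ m) 1)" by (simp add: norm_power)
  also have "\<dots> \<le> (real (degree (q ^ m)) + 1) * (LINT \<theta>|circle_measure. cmod (poly (q ^ m) (cis \<theta>)))"
    by (rule poly_one_le_circle_L1)
  also have "\<dots> = (real (degree (q ^ m)) + 1) * (LINT \<theta>|circle_measure. ?x \<theta> ^ m)"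
    by (simp add: norm_power)
  also have "\<dots> \<le> (real m * real (degree q) + 1) * (1 + X + t)"
  proof (intro mult_mono I)
    have "real (degree (q ^ m)) \<le> real (degree q * m)" using degree_power_le[of q m] by (simp only: of_nat_le_iff)
    then show "real (degree (q ^ m)) + 1 \<le> real m * real (degree q) + 1" by (simp add: mult.commute)
  qed auto
  finally show ?thesis unfolding X_def .
qed

section \<open>Unbounded norms and the bound on the critical exponent\<close>

text \<open>If the norms were bounded, the kernel inequality for the Dirichlet polynomial at 1 would
  bound \<open>N\<^sup>2\<close> by a constant times
  \<open>N * N powr (2 / m) * N powr (1 - \<alpha> / 2)\<close>. The exponent on the right is below
  2 when \<open>m > 4 / \<alpha>\<close>, so large \<open>N\<close> gives a contradiction.\<close>

lemma unbounded_Lp_norms: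
  assumes c: "0 < c" and w: "normalized_weight (power_weight c \<alpha>)"
    and \<alpha>: "0 < \<alpha>" "\<alpha> \<le> 2" and t: "A2_characteristic (power_weight c \<alpha>) \<le> ennreal t" "0 \<le> t"
    and m: "4 / \<alpha> < real m" and p: "2 * real m \<le> p"
  shows "\<not> bdd_above (range (\<lambda>n. weighted_Lp_norm (power_weight c \<alpha>) p (poly (orthonormal_poly (power_weight c \<alpha>) n))))"
proof
  let ?w = "power_weight c \<alpha>"
  define \<phi> where "\<phi> = orthonormal_poly ?w"
  have \<phi>: "orthonormal_polys ?w \<phi>" unfolding \<phi>_def by (rule orthonormal_polys_orthonormal_poly[OF w])
  assume "bdd_above (range (\<lambda>n. weighted_Lp_norm ?w p (poly (orthonormal_poly ?w n))))"
  then obtain B where B: "\<And>n. weighted_Lp_norm ?w p (poly (\<phi> n)) \<le> B"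
    unfolding bdd_above_def \<phi>_def by auto
  have m0: "0 < real m" using m \<alpha> by (intro less_trans[OF _ m]) simp
  have p0: "0 < p" using p m0 by linarith
  define E where "E = 1 + B powr p + t"
  have E: "1 \<le> E" using t unfolding E_def by simp
  have val: "(cmod (poly (\<phi> k) 1))\<^sup>2 \<le> (real m * E * real N) powr (2 / m)" if "k < N" for k N
  proof -
    let ?x = "cmod (poly (\<phi> k) 1)"
    let ?X = "LINT \<theta>|weight_measure ?w. cmod (poly (\<phi> k) (cis \<theta>)) powr p"
    have X0: "0 \<le> ?X" by simp
    \<comment> \<open>The norm includes the \<open>p\<close>-th root, so the bound \<open>B\<close>
      has to be raised to the power \<open>p\<close>.\<close>
    have "?X = (?X powr (1 / p)) powr p" using X0 p0 by (simp add: powr_powr)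
    also have "\<dots> \<le> B powr p"
      using B[of k] p0 unfolding weighted_Lp_norm_def by (intro powr_mono2) auto
    finally have X: "?X \<le> B powr p" .
    have deg: "degree (\<phi> k) = k" using \<phi> unfolding orthonormal_polys_def by blast
    have "?x ^ m \<le> (real m * real k + 1) * (1 + ?X + t)"
      using power_poly_one_le[OF w t p0 p, of "\<phi> k"] unfolding deg .
    also have "\<dots> \<le> (real m * real N) * E"
    proof (rule mult_mono)
      \<comment> \<open>From \<open>k + 1 \<le> N\<close> and \<open>m \<ge> 1\<close> the additive
        1 is absorbed: \<open>m * k + 1 \<le> m * (k + 1) \<le> m * N\<close>.\<close>
      have "real m * (real k + 1) \<le> real m * real N" using that by (intro mult_left_mono) auto
      moreover have "1 \<le> real m" using m0 by simp
      ultimately show "real m * real k + 1 \<le> real m * real N" by (simp add: algebra_simps)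
      show "1 + ?X + t \<le> E" using X unfolding E_def by simp
    qed (use X0 t in auto)
    finally have "?x ^ m \<le> real m * E * real N" by (simp add: mult_ac)
    then have "(?x ^ m) powr (2 / m) \<le> (real m * E * real N) powr (2 / m)"
      by (intro powr_mono2) auto
    moreover have "(?x ^ m) powr (2 / m) = ?x\<^sup>2"
    proof (cases "?x = 0")
      case False
      then have x: "0 < ?x" by simp
      then have "(?x ^ m) powr (2 / m) = ?x powr (real m * (2 / m))"
        by (simp only: powr_realpow[symmetric] powr_powr)
      also have "\<dots> = ?x powr (real 2)" using m0 by simp
      also have "\<dots> = ?x\<^sup>2" using x by (rule powr_realpow)
      finally show ?thesis .
    qed (use m0 in auto)
    ultimately show ?thesis by simp
  qed
  define K where "K = 5 * c * (real m * E) powr (2 / m)"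
  \<comment> \<open>The amount by which the exponent of \<open>N\<close> falls short of 2; it is
    positive exactly when \<open>m > 4 / \<alpha>\<close>.\<close>
  define \<delta> where "\<delta> = \<alpha> / 2 - 2 / m"
  have \<delta>: "0 < \<delta>" using m m0 \<alpha> unfolding \<delta>_def by (simp add: field_simps)
  have bound: "real N powr \<delta> \<le> K" if N: "0 < N" for N
  proof -
    let ?D = "LINT \<theta>|weight_measure ?w. (cmod (poly (dirichlet_poly N) (cis \<theta>)))\<^sup>2"
    have "(real N)\<^sup>2 = (cmod (poly (dirichlet_poly N) 1))\<^sup>2" by (simp add: poly_dirichlet_poly)
    also have "\<dots> \<le> (\<Sum>k<N. (cmod (poly (\<phi> k) 1))\<^sup>2) * ?D"
      by (rule norm_poly_squared_le_kernel[OF w \<phi> degree_dirichlet_poly[OF N]])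
    also have "\<dots> \<le> (real N * (real m * E * real N) powr (2 / m)) * (5 * c * real N powr (1 - \<alpha> / 2))"
    proof (rule mult_mono)
      show "(\<Sum>k<N. (cmod (poly (\<phi> k) 1))\<^sup>2) \<le> real N * (real m * E * real N) powr (2 / m)"
        using sum_bounded_above[of "{..<N}" "\<lambda>k. (cmod (poly (\<phi> k) 1))\<^sup>2", OF val] by simp
      show "?D \<le> 5 * c * real N powr (1 - \<alpha> / 2)"
        using N c \<alpha> by (intro dirichlet_poly_weighted_L2[OF w]) auto
    qed auto
    also have "\<dots> = K * (real N * real N powr (2 / m) * real N powr (1 - \<alpha> / 2))"
      using E m0 by (simp add: K_def powr_mult mult_ac)
    also have "real N * real N powr (2 / m) * real N powr (1 - \<alpha> / 2) = real N powr (2 - \<delta>)"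
    proof -
      have "real N * real N powr (2 / m) * real N powr (1 - \<alpha> / 2) =
         real N powr (1 + 2 / m + (1 - \<alpha> / 2))" using N by (simp only: powr_add powr_one)
      also have "1 + 2 / m + (1 - \<alpha> / 2) = 2 - \<delta>" by (simp add: \<delta>_def)
      finally show ?thesis .
    qed
    finally have "(real N)\<^sup>2 \<le> K * ((real N)\<^sup>2 / real N powr \<delta>)"
      using N by (simp add: powr_diff)
    then show ?thesis using N by (simp add: field_simps)
  qed
  have "K powr (1 / \<delta>) < real (Suc (nat \<lceil>K powr (1 / \<delta>)\<rceil>))" by linarith
  then obtain N where N: "0 < N" "K powr (1 / \<delta>) < real N" by blast
  have K: "0 \<le> K" using bound[of 1] by simp
  have "K = (K powr (1 / \<delta>)) powr \<delta>" using K \<delta> by (simp add: powr_powr)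
  also have "\<dots> < real N powr \<delta>" using N \<delta> by (intro powr_less_mono2) auto
  finally show False using bound[OF N(1)] by simp
qed

theorem lemma15:
  shows "\<exists>C::real. \<forall>t::real. 1 < t \<and> t < 2 \<longrightarrow> p_cr t < ereal (C * (t - 1) powr (- (1 / 2)))"
proof (intro exI[of _ 73] allI impI)
  fix t :: real assume t: "1 < t \<and> t < 2"
  define r where "r = sqrt (t - 1)"
  have r: "0 < r" "r < 1" "r\<^sup>2 = t - 1" using t by (simp_all add: r_def)
  \<comment> \<open>This choice makes the bound \<open>1 + 16 * s\<^sup>2\<close> equal to
    \<open>t\<close>.\<close>
  define s where "s = r / 4"
  have "16 * s\<^sup>2 = r\<^sup>2" by (simp add: s_def power_divide)
  with r(3) have st: "1 + 16 * s\<^sup>2 = t" by linarith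
  have s: "0 < s" "s \<le> 1" using r(1,2) by (simp_all add: s_def)
  define \<alpha> where "\<alpha> = s / 2"
  have \<alpha>: "0 < \<alpha>" "\<alpha> \<le> 2" using s by (simp_all add: \<alpha>_def)
  obtain c where c: "0 < c" and w: "normalized_weight (power_weight c \<alpha>)"
    using normalized_power_weight_exists[of \<alpha>] \<alpha> by auto
  have A2: "A2_characteristic (power_weight c \<alpha>) \<le> ennreal t"
    using A2_characteristic_power_weight[OF c s] unfolding st \<alpha>_def .
  \<comment> \<open>The least integer strictly above \<open>4 / \<alpha>\<close>.\<close>
  define m where "m = nat \<lfloor>4 / \<alpha>\<rfloor> + 1"
  have "0 < 4 / \<alpha>" using \<alpha> by simp
  then have m: "4 / \<alpha> < real m" "real m \<le> 4 / \<alpha> + 1" unfolding m_def by linarith+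
  have le: "p_cr t \<le> ereal (2 * real m)"
    unfolding p_cr_def
  proof (rule Sup_least, clarify)
    fix p :: real
    assume *: "\<forall>w. normalized_weight w \<and> A2_characteristic w \<le> ennreal t \<longrightarrow>
        bdd_above (range (\<lambda>n. weighted_Lp_norm w p (poly (orthonormal_poly w n))))"
    show "ereal p \<le> ereal (2 * real m)"
    proof (rule ccontr)
      assume "\<not> ereal p \<le> ereal (2 * real m)"
      then have "2 * real m \<le> p" by simp
      moreover have "0 \<le> t" using t by simp
      ultimately show False
        using unbounded_Lp_norms[OF c w \<alpha> A2 _ m(1)] *[rule_format, OF conjI[OF w A2]] by blast
    qed
  qed
  \<comment> \<open>Here \<open>\<alpha> = r / 8\<close>, so \<open>4 / \<alpha> = 32 / r\<close>.
    Since \<open>r < 1\<close>, the summand 2 is less than \<open>9 / r\<close>, and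
    \<open>64 + 9 = 73\<close>.\<close>
  have "2 * real m \<le> 64 / r + 2" using m(2) by (simp add: \<alpha>_def s_def)
  also have "\<dots> < 73 / r" using r(1,2) by (simp add: field_simps)
  also have "73 / r = 73 * (t - 1) powr (- (1 / 2))"
  proof -
    have "(t - 1) powr (1 / 2) = r" unfolding r_def using t by (intro powr_half_sqrt) simp
    then show ?thesis by (simp only: powr_minus divide_inverse)
  qed
  finally have "ereal (2 * real m) < ereal (73 * (t - 1) powr (- (1 / 2)))"
    unfolding less_ereal.simps(1) .
  with le show "p_cr t < ereal (73 * (t - 1) powr (- (1 / 2)))" by (rule le_less_trans)
qed

end
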